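(* Let $m,n\in\mathbb N$ with $m\geq32$ and $n\geq4$. Let $(A_1,\dots,A_{2n})$, $A_i\in M_{m\times m}(\mathbb R)$, be a Clifford system on $\mathbb R^m$. Then the cone $$C^4_{m,n}=\Bigl\{x\in\mathbb R^m\ \Big|\ \sum_{i=1}^n\langle x,A_ix\rangle^2=\sum_{i=1}^n\langle x,A_{n+i}x\rangle^2\Bigr\}$$ is an area-minimising hypersurface in $\mathbb R^m$.
   Context: A tuple $(A_1,\dots,A_k)$ of symmetric real $m\times m$ matrices is called a Clifford system on $\mathbb R^m$ if $A_iA_j+A_jA_i=2\delta_{ij}\mathbf 1_{m\times m}$ for all $i,j\in\{1,\dots,k\}$. Area-minimising is understood in the sense of sets of finite perimeter: the perimeter of a set $E$ in an open set $\Omega\subseteq\mathbb R^m$ is $P(E,\Omega)=\sup\{\int_E\mathrm{div}(g)\mid g\in C^1_c(\Omega,\mathbb R^m),\ \sup_x\|g(x)\|\leq1\}$. An open set $E\subset\Omega$ is minimal in $\Omega$ if for all bounded open $A\subseteq\Omega$ one has $P(E\cap A,\Omega\cap A)\leq P(F\cap A,\Omega\cap A)$ whenever $F\subseteq\Omega$ is a measurable set with $(F\cup E)\setminus(F\cap E)\Subset A$. The boundary $\partial E$ is area-minimising in $\Omega$ if and only if $E$ is minimal in $\Omega$. Here $\Omega=\mathbb R^m$ and $C^4_{m,n}=\partial E$ for $E=\{x\in\mathbb R^m\mid\sum_{i=1}^n\langle x,A_ix\rangle^2<\sum_{i=1}^n\langle x,A_{n+i}x\rangle^2\}$. *)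

theory Defs
  imports "HOL-Analysis.Analysis"
begin

text \<open>Clifford systems; the members of the tuple are indexed by \<open>1, \<dots>, k\<close>.\<close>

definition clifford_system :: "nat \<Rightarrow> (nat \<Rightarrow> real ^ 'm ^ 'm) \<Rightarrow> bool" where
  "clifford_system k A \<longleftrightarrow>
     (\<forall>i\<in>{1..k}. transpose (A i) = A i) \<and>
     (\<forall>i\<in>{1..k}. \<forall>j\<in>{1..k}.
        A i ** A j + A j ** A i = (if i = j then 2 else 0) *\<^sub>R mat 1)"

text \<open>
  \<open>C1c \<Omega>\<close> is the space of compactly supported continuously differentiable vector fields on the
  open set \<open>\<Omega>\<close>. A field is represented by its extension by zero to the whole space, which is
  again continuously differentiable, since its support is a compact subset of \<open>\<Omega>\<close>.
\<close>

definition C1c :: "'a::euclidean_space set \<Rightarrow> ('a \<Rightarrow> 'a) set" where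
  "C1c \<Omega> = {g.
     (\<exists>g' :: 'a \<Rightarrow> 'a \<Rightarrow>\<^sub>L 'a.
        (\<forall>x. (g has_derivative blinfun_apply (g' x)) (at x)) \<and> continuous_on UNIV g') \<and>
     compact (closure {x. g x \<noteq> 0}) \<and> closure {x. g x \<noteq> 0} \<subseteq> \<Omega>}"

definition divergence :: "('a::euclidean_space \<Rightarrow> 'a) \<Rightarrow> 'a \<Rightarrow> real" where
  "divergence g x = (\<Sum>b\<in>Basis. frechet_derivative g (at x) b \<bullet> b)"

text \<open>The perimeter may be infinite, so it takes values in the extended reals.\<close>

definition perimeter :: "'a::euclidean_space set \<Rightarrow> 'a set \<Rightarrow> ereal" where
  "perimeter E \<Omega> =
     (SUP g \<in> {g \<in> C1c \<Omega>. \<forall>x. norm (g x) \<le> 1}. ereal (LINT x:E|lebesgue. divergence g x))"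

definition minimal_in :: "'a::euclidean_space set \<Rightarrow> 'a set \<Rightarrow> bool" where
  "minimal_in E \<Omega> \<longleftrightarrow> open E \<and> E \<subseteq> \<Omega> \<and>
     (\<forall>A F. open A \<and> bounded A \<and> A \<subseteq> \<Omega> \<and> F \<in> sets lebesgue \<and> F \<subseteq> \<Omega> \<and>
        compact (closure ((F \<union> E) - (F \<inter> E))) \<and> closure ((F \<union> E) - (F \<inter> E)) \<subseteq> A \<longrightarrow>
        perimeter (E \<inter> A) (\<Omega> \<inter> A) \<le> perimeter (F \<inter> A) (\<Omega> \<inter> A))"

definition clifford_cone :: "nat \<Rightarrow> (nat \<Rightarrow> real ^ 'm ^ 'm) \<Rightarrow> (real ^ 'm) set" where
  "clifford_cone n A =
     {x. (\<Sum>i=1..n. (x \<bullet> (A i *v x))\<^sup>2) = (\<Sum>i=1..n. (x \<bullet> (A (n + i) *v x))\<^sup>2)}"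

definition clifford_domain :: "nat \<Rightarrow> (nat \<Rightarrow> real ^ 'm ^ 'm) \<Rightarrow> (real ^ 'm) set" where
  "clifford_domain n A =
     {x. (\<Sum>i=1..n. (x \<bullet> (A i *v x))\<^sup>2) < (\<Sum>i=1..n. (x \<bullet> (A (n + i) *v x))\<^sup>2)}"

end

theory Submission
  imports Defs
begin

text \<open>
  Let \<open>a\<close> and \<open>b\<close> be the two sums of squares, \<open>D = a - b\<close>, \<open>s = a + b\<close> and \<open>t = \<parallel>x\<parallel>\<^sup>2\<close>.
  The quadratic forms \<open>\<langle>x, A\<^sub>i x\<rangle>\<close> are harmonic with mutually orthogonal gradients of length
  \<open>2 \<parallel>x\<parallel>\<close>, so the divergence of a field built from \<open>\<nabla>D\<close>, \<open>\<nabla>s\<close> and \<open>x\<close> with coefficients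
  depending on \<open>D\<close>, \<open>s\<close>, \<open>t\<close> depends on \<open>D\<close>, \<open>s\<close>, \<open>t\<close> only. The unit normals of the level sets
  of \<open>D s\<^bsup>2/3\<^esup> t\<close> form a subcalibration: their divergence has the sign of \<open>D\<close>, which reduces to a
  polynomial inequality with positive coefficients in \<open>t\<^sup>2\<close>, \<open>s\<close>, \<open>D\<^sup>2\<close> and \<open>s\<^sup>2 - D\<^sup>2\<close>. The exponent
  \<open>2/3\<close> and the factor \<open>t\<close> are what makes \<open>n = 4\<close> work. The unit normal is singular where \<open>s = 0\<close>;
  with \<open>Y\<close> a polynomial multiple of the gradient, it is replaced by the smooth fields
  \<open>Y / sqrt (\<parallel>Y\<parallel>\<^sup>2 + \<epsilon>)\<close>, whose divergence has the same sign and is dominated, uniformly in \<open>\<epsilon>\<close>,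
  by a multiple of its limit. That limit is locally integrable by Fatou's lemma, because the
  divergences have one sign on each side of the cone.

  Given a competitor \<open>F\<close> and a test field \<open>g\<close> for \<open>E\<close>, the field that interpolates between \<open>g\<close> and
  the subcalibration by a cutoff equal to 1 on the symmetric difference is a test field for \<open>F\<close>.
\<close>

section \<open>Continuously differentiable maps and cutoffs\<close>

text \<open>Continuity of the derivative is asked for direction by direction, which is easy to
  verify for sums, products and compositions. In finite dimension it amounts to continuity in
  operator norm.\<close>

definition C1_fun :: "('a::real_normed_vector \<Rightarrow> 'b::real_normed_vector) \<Rightarrow> bool" where
  "C1_fun f \<longleftrightarrow> (\<exists>f'. (\<forall>x. (f has_derivative f' x) (at x)) \<and> (\<forall>v. continuous_on UNIV (\<lambda>x. f' x v)))"

lemma C1_funI: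
  assumes "\<And>x. (f has_derivative f' x) (at x)" "\<And>v. continuous_on UNIV (\<lambda>x. f' x v)"
  shows "C1_fun f"
  using assms unfolding C1_fun_def by blast

lemma C1_fun_has_derivative:
  assumes "C1_fun f"
  shows "(f has_derivative frechet_derivative f (at x)) (at x)"
  using assms unfolding C1_fun_def
  by (metis differentiableI frechet_derivative_works)

lemma C1_fun_continuous_derivative:
  assumes "C1_fun f"
  shows "continuous_on UNIV (\<lambda>x. frechet_derivative f (at x) v)"
proof -
  obtain f' where f': "\<And>x. (f has_derivative f' x) (at x)" "\<And>v. continuous_on UNIV (\<lambda>x. f' x v)"
    using assms unfolding C1_fun_def by blast
  have "frechet_derivative f (at x) = f' x" for x
    using f'(1) by (metis frechet_derivative_at)
  then show ?thesis using f'(2) by simp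
qed

lemma C1_fun_continuous:
  assumes "C1_fun f"
  shows "continuous_on UNIV f"
  by (intro continuous_at_imp_continuous_on ballI has_derivative_continuous[OF C1_fun_has_derivative[OF assms]])

lemma C1_fun_bounded_linear: "bounded_linear f \<Longrightarrow> C1_fun f"
  by (rule C1_funI[where f'="\<lambda>_. f"]) (auto intro: bounded_linear_imp_has_derivative)

lemma C1_fun_const: "C1_fun (\<lambda>x. c)"
  by (rule C1_funI[where f'="\<lambda>_ _. 0"]) auto

lemma C1_fun_id: "C1_fun (\<lambda>x. x)"
  by (rule C1_fun_bounded_linear) (rule bounded_linear_ident)

lemma C1_fun_add:
  assumes "C1_fun f" "C1_fun g"
  shows "C1_fun (\<lambda>x. f x + g x)"
proof -
  obtain f' where f': "\<And>x. (f has_derivative f' x) (at x)" "\<And>v. continuous_on UNIV (\<lambda>x. f' x v)"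
    using assms unfolding C1_fun_def by blast
  obtain g' where g': "\<And>x. (g has_derivative g' x) (at x)" "\<And>v. continuous_on UNIV (\<lambda>x. g' x v)"
    using assms unfolding C1_fun_def by blast
  show ?thesis
    by (rule C1_funI[where f'="\<lambda>x v. f' x v + g' x v"])
      (auto intro!: has_derivative_add continuous_on_add f' g')
qed

lemma C1_fun_bilinear:
  assumes "bounded_bilinear B" "C1_fun f" "C1_fun g"
  shows "C1_fun (\<lambda>x. B (f x) (g x))"
proof -
  interpret bounded_bilinear B by fact
  obtain f' where f': "\<And>x. (f has_derivative f' x) (at x)" "\<And>v. continuous_on UNIV (\<lambda>x. f' x v)"
    using assms unfolding C1_fun_def by blast
  obtain g' where g': "\<And>x. (g has_derivative g' x) (at x)" "\<And>v. continuous_on UNIV (\<lambda>x. g' x v)"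
    using assms unfolding C1_fun_def by blast
  have "continuous_on UNIV (\<lambda>x. B (f x) (g' x v) + B (f' x v) (g x))" for v
    by (intro continuous_on_add continuous_on f' g' C1_fun_continuous[OF assms(2)]
        C1_fun_continuous[OF assms(3)])
  then show ?thesis
    by (rule C1_funI[OF FDERIV[OF f'(1) g'(1)]])
qed

lemmas C1_fun_scaleR = C1_fun_bilinear[OF bounded_bilinear_scaleR]
lemmas C1_fun_inner = C1_fun_bilinear[OF bounded_bilinear_inner]
lemmas C1_fun_mult = C1_fun_bilinear[OF bounded_bilinear_mult]

lemma C1_fun_minus: "C1_fun f \<Longrightarrow> C1_fun (\<lambda>x. - f x)"
  using C1_fun_scaleR[OF C1_fun_const[of "-1::real"], of f] by simp

lemma C1_fun_diff:
  assumes "C1_fun f" "C1_fun g"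
  shows "C1_fun (\<lambda>x. f x - g x)"
  using C1_fun_add[OF assms(1) C1_fun_minus[OF assms(2)]] by simp

lemma C1_fun_sum:
  assumes "\<And>i. i \<in> I \<Longrightarrow> C1_fun (f i)"
  shows "C1_fun (\<lambda>x. \<Sum>i\<in>I. f i x)"
  using assms by (induction I rule: infinite_finite_induct) (auto intro: C1_fun_const C1_fun_add)

lemma C1_fun_power:
  fixes f :: "'a::real_normed_vector \<Rightarrow> real"
  assumes "C1_fun f"
  shows "C1_fun (\<lambda>x. f x ^ k)"
  by (induction k) (auto intro: C1_fun_const C1_fun_mult assms)

lemma C1_fun_compose_real:
  fixes f :: "'a::real_normed_vector \<Rightarrow> real"
  assumes "C1_fun f"
    and "\<And>x. (h has_real_derivative h' (f x)) (at (f x))"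
    and "continuous_on (range f) h'"
  shows "C1_fun (\<lambda>x. h (f x))"
proof -
  obtain f' where f': "\<And>x. (f has_derivative f' x) (at x)" "\<And>v. continuous_on UNIV (\<lambda>x. f' x v)"
    using assms unfolding C1_fun_def by blast
  have "((\<lambda>x. h (f x)) has_derivative (\<lambda>v. h' (f x) * f' x v)) (at x)" for x
    using has_derivative_compose[OF f'(1)[of x] assms(2)[of x, unfolded has_field_derivative_def]] by simp
  moreover have "continuous_on UNIV (\<lambda>x. h' (f x) * f' x v)" for v
    by (intro continuous_on_mult f' continuous_on_compose2[OF assms(3)] C1_fun_continuous assms) auto
  ultimately show ?thesis by (rule C1_funI)
qed

lemma frechet_derivative_eq_0_outside_support:
  assumes "x \<notin> closure {x. g x \<noteq> 0}"
  shows "frechet_derivative g (at x) = (\<lambda>v. 0)"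
proof -
  have "(g has_derivative (\<lambda>v. 0)) (at x)"
  proof (rule has_derivative_transform_within_open[where f="\<lambda>_. 0"])
    show "open (- closure {x. g x \<noteq> 0})" by (rule open_Compl) (rule closed_closure)
    show "x \<in> - closure {x. g x \<noteq> 0}" using assms by simp
    show "0 = g y" if "y \<in> - closure {x. g x \<noteq> 0}" for y
      using that closure_subset[of "{x. g x \<noteq> 0}"] by auto
  qed simp
  then show ?thesis by (metis frechet_derivative_at)
qed

section \<open>Test fields and the calculus of divergence\<close>

lemma C1cI:
  assumes "C1_fun g" "compact K" "K \<subseteq> \<Omega>" "\<And>x. x \<notin> K \<Longrightarrow> g x = 0"
  shows "g \<in> C1c \<Omega>"
proof -
  define g' where "g' x = Blinfun (frechet_derivative g (at x))" for x
  have d: "(g has_derivative frechet_derivative g (at x)) (at x)" for x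
    using C1_fun_has_derivative[OF assms(1)] .
  have g': "blinfun_apply (g' x) = frechet_derivative g (at x)" for x
    unfolding g'_def by (rule bounded_linear_Blinfun_apply) (rule has_derivative_bounded_linear[OF d])
  \<comment> \<open>Finitely many basis directions determine a linear map, so directional continuity
    gives continuity in operator norm.\<close>
  have c: "continuous_on UNIV g'"
    by (rule continuous_on_blinfun_componentwise)
      (simp add: g' C1_fun_continuous_derivative[OF assms(1)])
  have sub: "closure {x. g x \<noteq> 0} \<subseteq> K"
    by (rule closure_minimal) (use assms compact_imp_closed in auto)
  then have "compact (closure {x. g x \<noteq> 0})"
    by (meson assms(2) closed_closure closed_subset compact_imp_closed compact_Int_closed
        compact_eq_bounded_closed bounded_subset)
  moreover have "\<forall>x. (g has_derivative blinfun_apply (g' x)) (at x)" using d g' by simp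
  ultimately show ?thesis
    unfolding C1c_def using c sub assms(3) by blast
qed

lemma C1c_C1_fun: "g \<in> C1c \<Omega> \<Longrightarrow> C1_fun g"
proof -
  assume "g \<in> C1c \<Omega>"
  then obtain g' where g': "\<And>x. (g has_derivative blinfun_apply (g' x)) (at x)" "continuous_on UNIV g'"
    unfolding C1c_def by auto
  show "C1_fun g"
    by (rule C1_funI[OF g'(1)]) (intro continuous_intros g'(2))
qed

lemma C1c_support:
  assumes "g \<in> C1c \<Omega>"
  shows "compact (closure {x. g x \<noteq> 0})" "closure {x. g x \<noteq> 0} \<subseteq> \<Omega>"
  using assms unfolding C1c_def by auto

lemma divergence_has_derivative:
  assumes "(g has_derivative g') (at x)"
  shows "divergence g x = (\<Sum>b\<in>Basis. g' b \<bullet> b)"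
  unfolding divergence_def using frechet_derivative_at[OF assms] by simp

lemma divergence_add:
  assumes "C1_fun f" "C1_fun g"
  shows "divergence (\<lambda>x. f x + g x) x = divergence f x + divergence g x"
  using divergence_has_derivative[OF has_derivative_add[OF C1_fun_has_derivative[OF assms(1)]
      C1_fun_has_derivative[OF assms(2)]]]
  by (simp add: divergence_def inner_add_left sum.distrib)

text \<open>The second term of the product rule comes from expanding \<open>g x\<close> in the
  basis. The derivative of \<open>f\<close> is a parameter so that explicit formulas can be inserted
  later.\<close>

lemma divergence_scaleR:
  assumes f: "(f has_derivative f') (at x)" and g: "C1_fun g"
  shows "divergence (\<lambda>x. f x *\<^sub>R g x) x = f x * divergence g x + f' (g x)"
proof -
  have lin: "linear f'" using f has_derivative_linear by blast
  have "f' (g x) = f' (\<Sum>b\<in>Basis. (g x \<bullet> b) *\<^sub>R b)" by (simp add: euclidean_representation)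
  also have "\<dots> = (\<Sum>b\<in>Basis. (g x \<bullet> b) * f' b)" by (simp add: linear_sum[OF lin] linear_scale[OF lin])
  finally have *: "f' (g x) = (\<Sum>b\<in>Basis. f' b * (g x \<bullet> b))" by (simp add: mult.commute)
  show ?thesis
    using divergence_has_derivative[OF has_derivative_scaleR[OF f C1_fun_has_derivative[OF g, of x]]]
    by (simp add: divergence_def inner_add_left sum.distrib * sum_distrib_left)
qed

lemma divergence_scaleR_C1:
  assumes "C1_fun f" "C1_fun g"
  shows "divergence (\<lambda>x. f x *\<^sub>R g x) x = f x * divergence g x + frechet_derivative f (at x) (g x)"
  by (rule divergence_scaleR[OF C1_fun_has_derivative[OF assms(1)] assms(2)])

lemma divergence_sum:
  assumes "\<And>i. i \<in> I \<Longrightarrow> C1_fun (f i)"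
  shows "divergence (\<lambda>x. \<Sum>i\<in>I. f i x) x = (\<Sum>i\<in>I. divergence (f i) x)"
proof -
  have "divergence (\<lambda>x. \<Sum>i\<in>I. f i x) x = (\<Sum>b\<in>Basis. (\<Sum>i\<in>I. frechet_derivative (f i) (at x) b) \<bullet> b)"
    by (rule divergence_has_derivative) (intro has_derivative_sum C1_fun_has_derivative assms)
  also have "\<dots> = (\<Sum>i\<in>I. divergence (f i) x)"
    unfolding divergence_def inner_sum_left by (rule sum.swap)
  finally show ?thesis .
qed

lemma divergence_continuous: "C1_fun g \<Longrightarrow> continuous_on UNIV (divergence g)"
  unfolding divergence_def by (intro continuous_intros C1_fun_continuous_derivative)

lemma divergence_outside_support: "x \<notin> closure {x. g x \<noteq> 0} \<Longrightarrow> divergence g x = 0"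
  unfolding divergence_def by (simp add: frechet_derivative_eq_0_outside_support)

section \<open>A continuously differentiable step and cutoff functions\<close>

definition plus_square :: "real \<Rightarrow> real" where
  "plus_square u = (max 0 u)\<^sup>2"

lemma plus_square_deriv: "(plus_square has_real_derivative 2 * max 0 u) (at u)"
proof -
  consider "u < 0" | "u = 0" | "u > 0" by linarith
  then show ?thesis
  proof cases
    case 1
    show ?thesis
      by (rule has_field_derivative_transform_within_open[where f="\<lambda>_. 0" and S="{..<0}"])
        (use 1 in \<open>auto simp: plus_square_def\<close>)
  next
    case 3
    show ?thesis
      by (rule has_field_derivative_transform_within_open[where f="\<lambda>u. u\<^sup>2" and S="{0<..}"])
        (use 3 in \<open>auto simp: plus_square_def intro!: derivative_eq_intros\<close>)
  next
    case 2
    \<comment> \<open>At the joint the difference quotient is at most \<open>\<bar>h\<bar>\<close>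
      in absolute value, so both one-sided derivatives are 0.\<close>
    have "((\<lambda>h. plus_square h / h) \<longlongrightarrow> 0) (at 0)"
    proof (rule Lim_null_comparison)
      show "\<forall>\<^sub>F h in at 0. norm (plus_square h / h) \<le> \<bar>h\<bar>"
        by (rule always_eventually) (auto simp: plus_square_def max_def power2_eq_square)
      show "((\<lambda>h::real. \<bar>h\<bar>) \<longlongrightarrow> 0) (at 0)" by (auto intro!: tendsto_eq_intros)
    qed
    then show ?thesis using 2 by (simp add: DERIV_def plus_square_def)
  qed
qed

text \<open>A transition from 0 on the negative half-line to 1 beyond 1. The denominator is positive
  because \<open>u\<close> and \<open>1 - u\<close> are never both nonpositive.\<close>

definition step :: "real \<Rightarrow> real" where
  "step u = plus_square u / (plus_square u + plus_square (1 - u))"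

definition step' :: "real \<Rightarrow> real" where
  "step' u = (2 * max 0 u * plus_square (1 - u) + plus_square u * (2 * max 0 (1 - u))) /
     (plus_square u + plus_square (1 - u))\<^sup>2"

lemma plus_square_nonneg: "plus_square u \<ge> 0"
  by (simp add: plus_square_def)

lemma plus_square_pos: "plus_square u + plus_square (1 - u) > 0"
proof (cases "u > 0")
  case True
  then have "plus_square u > 0" by (simp add: plus_square_def)
  then show ?thesis using plus_square_nonneg[of "1 - u"] by linarith
next
  case False
  then have "plus_square (1 - u) > 0" by (simp add: plus_square_def)
  then show ?thesis using plus_square_nonneg[of "u"] by linarith
qed

lemma step_deriv: "(step has_real_derivative step' u) (at u)"
proof -
  have 1: "((\<lambda>u. plus_square (1 - u)) has_real_derivative (2 * max 0 (1 - u)) * (-1)) (at u)"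
    by (rule DERIV_chain2[OF plus_square_deriv]) (auto intro!: derivative_eq_intros)
  have 2: "(p' * (P + Q) - P * (p' + q' * (-1))) / ((P + Q) * (P + Q)) = (p' * Q + P * q') / (P + Q)\<^sup>2"
    for P Q p' q' :: real
    by (simp add: power2_eq_square algebra_simps)
  show ?thesis
    unfolding step_def[abs_def] step'_def
    using DERIV_divide[OF plus_square_deriv DERIV_add[OF plus_square_deriv 1] less_imp_neq[OF plus_square_pos, symmetric]]
    unfolding 2 .
qed

lemma step'_continuous: "continuous_on S step'"
proof -
  have c: "continuous_on S (\<lambda>x. plus_square (f x))" if "continuous_on S f" for f
    unfolding plus_square_def by (intro continuous_intros that)
  have "(plus_square u + plus_square (1 - u))\<^sup>2 \<noteq> 0" for u
    using plus_square_pos[of u] by simp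
  moreover have "continuous_on S (\<lambda>u. plus_square (1 - u))" by (rule c) (intro continuous_intros)
  moreover have "continuous_on S plus_square" using c[OF continuous_on_id] .
  ultimately show ?thesis
    unfolding step'_def by (intro continuous_intros ballI)
qed

lemma step'_nonneg: "step' u \<ge> 0"
  unfolding step'_def by (auto intro!: divide_nonneg_nonneg add_nonneg_nonneg mult_nonneg_nonneg plus_square_nonneg)

lemma step_bounds: "0 \<le> step u" "step u \<le> 1"
  unfolding step_def using plus_square_pos[of u] plus_square_nonneg[of u] plus_square_nonneg[of "1-u"]
  by auto

lemma step_eq_0: "u \<le> 0 \<Longrightarrow> step u = 0"
  by (simp add: step_def plus_square_def)

lemma step_eq_1: "u \<ge> 1 \<Longrightarrow> step u = 1"
  by (simp add: step_def plus_square_def)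

lemma C1_fun_step: "C1_fun f \<Longrightarrow> C1_fun (\<lambda>x. step (f x))"
  by (rule C1_fun_compose_real[OF _ step_deriv step'_continuous])

lemma C1_fun_plus_square: "C1_fun f \<Longrightarrow> C1_fun (\<lambda>x. plus_square (f x))"
  by (rule C1_fun_compose_real[where h=plus_square and h'="\<lambda>u. 2 * max 0 u"])
    (auto intro!: plus_square_deriv continuous_intros)

text \<open>Finitely many balls cover \<open>K\<close> with their closed balls inside
  \<open>A\<close>. The sum \<open>\<sigma>\<close> of truncated paraboloids over these balls is
  positive on \<open>K\<close> and vanishes outside them; divided by a positive lower bound
  \<open>c\<close> on \<open>K\<close> and fed into \<open>step\<close>, it becomes 1 on
  \<open>K\<close>.\<close>

lemma C1_cutoff:
  fixes K A :: "'a::euclidean_space set"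
  assumes "compact K" "open A" "K \<subseteq> A"
  obtains ch L where "C1_fun (ch :: 'a \<Rightarrow> real)" "compact L" "L \<subseteq> A" "\<And>x. x \<notin> L \<Longrightarrow> ch x = 0"
    "\<And>x. x \<in> K \<Longrightarrow> ch x = 1" "\<And>x. 0 \<le> ch x" "\<And>x. ch x \<le> 1"
proof -
  have "\<exists>r. r > 0 \<and> cball x r \<subseteq> A" if "x \<in> K" for x
    using assms(2,3) open_contains_cball that by blast
  then obtain r where r: "\<And>x. x \<in> K \<Longrightarrow> r x > 0 \<and> cball x (r x) \<subseteq> A" by metis
  obtain C where C: "C \<subseteq> K" "finite C" "K \<subseteq> (\<Union>x\<in>C. ball x (r x))"
    by (rule compactE_image[OF assms(1), where C=K and f="\<lambda>x. ball x (r x)"]) (use r in auto)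
  define L where "L = (\<Union>x\<in>C. cball x (r x))"
  define \<sigma> where "\<sigma> y = (\<Sum>z\<in>C. plus_square ((r z)\<^sup>2 - (y - z) \<bullet> (y - z)))" for y
  have \<sigma>: "C1_fun \<sigma>"
    unfolding \<sigma>_def
    by (intro C1_fun_sum C1_fun_plus_square C1_fun_diff C1_fun_inner C1_fun_id C1_fun_const)
  have pos: "\<sigma> y > 0" if yK: "y \<in> K" for y
  proof -
    obtain z where z: "z \<in> C" "y \<in> ball z (r z)" using C(3) yK by blast
    then have "norm (y - z) < r z" by (simp add: dist_norm norm_minus_commute)
    then have "(norm (y - z))\<^sup>2 < (r z)\<^sup>2" by (simp add: power_strict_mono)
    then have "plus_square ((r z)\<^sup>2 - (y - z) \<bullet> (y - z)) > 0"
      by (simp add: plus_square_def dot_square_norm)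
    then show ?thesis unfolding \<sigma>_def
      using C(2) z(1) plus_square_nonneg by (intro sum_pos2) auto
  qed
  have "\<exists>c>0. \<forall>y\<in>K. \<sigma> y \<ge> c"
  proof (cases "K = {}")
    case True then show ?thesis by (intro exI[of _ 1]) auto
  next
    case False
    then obtain y where "y \<in> K" "\<forall>z\<in>K. \<sigma> y \<le> \<sigma> z"
      using continuous_attains_inf[OF assms(1) False] C1_fun_continuous[OF \<sigma>] continuous_on_subset by blast
    then show ?thesis using pos by blast
  qed
  then obtain c where c: "c > 0" "\<And>y. y \<in> K \<Longrightarrow> \<sigma> y \<ge> c" by blast
  show thesis
  proof (rule that[of "\<lambda>y. step ((1 / c) * \<sigma> y)" L])
    show "C1_fun (\<lambda>y. step ((1 / c) * \<sigma> y))" by (intro C1_fun_step C1_fun_mult \<sigma> C1_fun_const)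
    show "compact L" unfolding L_def using C by (intro compact_UN) auto
    show "L \<subseteq> A" unfolding L_def using C r by blast
    show "step ((1 / c) * \<sigma> y) = 0" if "y \<notin> L" for y
    proof -
      have "plus_square ((r z)\<^sup>2 - (y - z) \<bullet> (y - z)) = 0" if "z \<in> C" for z
      proof -
        have "r z < norm (y - z)" "r z > 0"
          using \<open>y \<notin> L\<close> \<open>z \<in> C\<close> C(1) r by (auto simp: L_def dist_norm norm_minus_commute)
        then have "(r z)\<^sup>2 \<le> (norm (y - z))\<^sup>2" by (intro power_mono) auto
        then show ?thesis by (simp add: plus_square_def dot_square_norm)
      qed
      then show ?thesis by (simp add: \<sigma>_def step_eq_0)
    qed
    show "step ((1 / c) * \<sigma> y) = 1" if "y \<in> K" for y
      using c that by (intro step_eq_1) (auto simp: field_simps)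
  qed (rule step_bounds)+
qed

section \<open>The divergence theorem for compactly supported fields\<close>

lemma integrable_compact_support:
  fixes f :: "'a::euclidean_space \<Rightarrow> real"
  assumes "continuous_on UNIV f" "compact K" "\<And>x. x \<notin> K \<Longrightarrow> f x = 0"
  shows "integrable lebesgue f"
proof -
  have "integrable lborel (\<lambda>x. indicator K x *\<^sub>R f x)"
    by (intro borel_integrable_compact assms(2) continuous_on_subset[OF assms(1)]) auto
  moreover have "(\<lambda>x. indicator K x *\<^sub>R f x) = f"
    using assms(3) by (force simp: indicator_def)
  ultimately show ?thesis
    by (simp add: integrable_completion borel_measurable_continuous_onI assms(1))
qed

lemma support_subset:
  assumes "compact (K :: 'a::euclidean_space set)" "\<And>x. x \<notin> K \<Longrightarrow> f x = 0"
  shows "closure {x. f x \<noteq> 0} \<subseteq> K"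
  by (rule closure_minimal) (use assms compact_imp_closed in auto)

lemma frechet_derivative_eq_0_outside_compact:
  fixes f :: "'a::euclidean_space \<Rightarrow> 'b::real_normed_vector"
  assumes "compact K" "\<And>x. x \<notin> K \<Longrightarrow> f x = 0" "y \<notin> K"
  shows "frechet_derivative f (at y) = (\<lambda>v. 0)"
  using frechet_derivative_eq_0_outside_support[of y f] support_subset[of K f] assms by blast

text \<open>Difference quotients integrate to 0 by translation invariance of Lebesgue measure. They
  are bounded by the mean value theorem and vanish outside a fixed ball, so dominated convergence
  passes this to the derivative.\<close>

lemma integral_frechet_derivative_eq_0:
  fixes u :: "'a::euclidean_space \<Rightarrow> real"
  assumes u: "C1_fun u" and K: "compact K" "\<And>x. x \<notin> K \<Longrightarrow> u x = 0"
  shows "(\<integral>x. frechet_derivative u (at x) b \<partial>lborel) = 0"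
proof -
  define D where "D x = frechet_derivative u (at x) b" for x
  have contD: "continuous_on UNIV D"
    unfolding D_def by (rule C1_fun_continuous_derivative[OF u])
  have contu: "continuous_on UNIV u" by (rule C1_fun_continuous[OF u])
  have D0: "D x = 0" if "x \<notin> K" for x
    unfolding D_def using frechet_derivative_eq_0_outside_compact[OF K] that by simp
  have "bounded (D ` K)"
    by (intro compact_imp_bounded compact_continuous_image K continuous_on_subset[OF contD]) simp
  then obtain L0 where L0: "\<And>x. x \<in> K \<Longrightarrow> \<bar>D x\<bar> \<le> L0" unfolding bounded_iff by auto
  \<comment> \<open>\<open>L0\<close> may be negative when \<open>K\<close> is empty.\<close>
  define L where "L = max L0 0"
  have L: "\<bar>D x\<bar> \<le> L" for x
    using L0[of x] D0[of x] unfolding L_def by (cases "x \<in> K") auto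
  obtain R where R: "K \<subseteq> cball 0 R" using compact_imp_bounded[OF K(1)] unfolding bounded_iff by (auto simp: subset_eq)
  define h :: "nat \<Rightarrow> real" where "h k = 1 / real (Suc k)" for k
  have h: "0 < h k" "h k \<le> 1" for k unfolding h_def by auto
  have der: "((\<lambda>t. u (x + t *\<^sub>R b)) has_real_derivative D (x + t *\<^sub>R b)) (at t)" for x t
  proof -
    have 1: "((\<lambda>t. x + t *\<^sub>R b) has_derivative (\<lambda>s. s *\<^sub>R b)) (at t)"
      by (auto intro!: derivative_eq_intros)
    have "((\<lambda>t. u (x + t *\<^sub>R b)) has_derivative (\<lambda>s. frechet_derivative u (at (x + t *\<^sub>R b)) (s *\<^sub>R b))) (at t)"
      by (rule has_derivative_compose[OF 1 C1_fun_has_derivative[OF u]])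
    moreover have "frechet_derivative u (at (x + t *\<^sub>R b)) (s *\<^sub>R b) = D (x + t *\<^sub>R b) * s" for s
      using has_derivative_linear[OF C1_fun_has_derivative[OF u]]
      unfolding D_def by (simp add: linear_scale)
    ultimately show ?thesis unfolding has_field_derivative_def by (simp only:)
  qed
  define q where "q k x = (u (x + h k *\<^sub>R b) - u x) / h k" for k x
  have qbound: "\<bar>q k x\<bar> \<le> L" for k x
  proof -
    obtain z where "u (x + h k *\<^sub>R b) - u (x + 0 *\<^sub>R b) = (h k - 0) * D (x + z *\<^sub>R b)"
      using MVT2[of 0 "h k" "\<lambda>t. u (x + t *\<^sub>R b)" "\<lambda>t. D (x + t *\<^sub>R b)"] h der by auto
    then have "q k x = D (x + z *\<^sub>R b)" using h(1)[of k] unfolding q_def by simp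
    then show ?thesis using L by simp
  qed
  have q0: "q k x = 0" if "x \<notin> cball 0 (R + norm b)" for k x
  proof -
    have n: "norm x > R + norm b" using that by auto
    \<comment> \<open>The shifts satisfy \<open>h k \<le> 1\<close>, so enlarging the radius by
      \<open>norm b\<close> keeps both arguments of the quotient off \<open>K\<close>.\<close>
    have "x \<notin> K" using R n by (smt (verit) mem_cball_0 norm_ge_zero subsetD)
    moreover have "x + h k *\<^sub>R b \<notin> K"
    proof
      assume "x + h k *\<^sub>R b \<in> K"
      then have "norm (x + h k *\<^sub>R b) \<le> R" using R by auto
      moreover have "norm x \<le> norm (x + h k *\<^sub>R b) + norm (h k *\<^sub>R b)"
        by (metis add_diff_cancel_right' norm_triangle_ineq4)
      moreover have "norm (h k *\<^sub>R b) \<le> norm b"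
        using h[of k] by (simp add: mult_left_le_one_le)
      ultimately show False using n by linarith
    qed
    ultimately show ?thesis using K(2) unfolding q_def by simp
  qed
  have mu: "u \<in> borel_measurable borel" by (rule borel_measurable_continuous_onI[OF contu])
  have iu: "integrable lborel u"
    using integrable_compact_support[OF contu K] mu by (simp add: integrable_completion)
  have tr: "integrable lborel (\<lambda>x. u (x + c))" "(\<integral>x. u (x + c) \<partial>lborel) = (\<integral>x. u x \<partial>lborel)" for c
  proof -
    have d: "distr lborel borel ((+) c) = (lborel :: 'a measure)" by (rule lborel_distr_plus)
    have "integrable (distr lborel borel ((+) c)) u" using iu d by simp
    then show "integrable lborel (\<lambda>x. u (x + c))"
      using mu by (subst (asm) integrable_distr_eq) (auto simp: add.commute)
    have "(\<integral>x. u x \<partial>(distr lborel borel ((+) c))) = (\<integral>x. u (c + x) \<partial>lborel)"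
      using mu by (subst integral_distr) auto
    then show "(\<integral>x. u (x + c) \<partial>lborel) = (\<integral>x. u x \<partial>lborel)" using d by (simp add: add.commute)
  qed
  have iq: "(\<integral>x. q k x \<partial>lborel) = 0" for k
    unfolding q_def using tr iu by simp
  have mD: "D \<in> borel_measurable lborel" using borel_measurable_continuous_onI[OF contD] by simp
  have "(\<lambda>k. \<integral>x. q k x \<partial>lborel) \<longlonglongrightarrow> (\<integral>x. D x \<partial>lborel)"
  proof (rule integral_dominated_convergence[where w="\<lambda>x. indicator (cball 0 (R + norm b)) x *\<^sub>R L"])
    show "integrable lborel (\<lambda>x. indicator (cball (0::'a) (R + norm b)) x *\<^sub>R L)"
      by (intro borel_integrable_compact) auto
    show "q k \<in> borel_measurable lborel" for k
      unfolding q_def using tr(1) iu by (auto intro!: borel_measurable_divide borel_measurable_diff)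
    show "AE x in lborel. (\<lambda>k. q k x) \<longlonglongrightarrow> D x"
    proof (rule AE_I2)
      fix x
      have "((\<lambda>t. (u (x + t *\<^sub>R b) - u x) / t) \<longlongrightarrow> D x) (at 0)"
        using der[of x 0] by (simp add: DERIV_def)
      moreover have "filterlim h (at 0) sequentially"
        unfolding h_def[abs_def] using LIMSEQ_inverse_real_of_nat
        by (intro filterlim_atI) (auto simp: inverse_eq_divide)
      ultimately show "(\<lambda>k. q k x) \<longlonglongrightarrow> D x"
        unfolding q_def by (rule filterlim_compose)
    qed
    show "AE x in lborel. norm (q k x) \<le> indicator (cball 0 (R + norm b)) x *\<^sub>R L" for k
      using qbound q0 by (intro AE_I2) (auto simp: indicator_def)
  qed (use mD in auto)
  then have "(\<integral>x. D x \<partial>lborel) = 0" using iq LIMSEQ_unique tendsto_const by (metis (no_types, lifting) ext)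
  then show ?thesis unfolding D_def .
qed

lemma integral_divergence_eq_0:
  fixes V :: "'a::euclidean_space \<Rightarrow> 'a"
  assumes V: "C1_fun V" and K: "compact K" "\<And>x. x \<notin> K \<Longrightarrow> V x = 0"
  shows "(\<integral>x. divergence V x \<partial>lebesgue) = 0"
proof -
  have V': "C1_fun (\<lambda>x. V x \<bullet> b)" for b by (intro C1_fun_inner V C1_fun_const)
  have eq: "frechet_derivative (\<lambda>x. V x \<bullet> b) (at x) b = frechet_derivative V (at x) b \<bullet> b" for b x
    using frechet_derivative_at[OF has_derivative_inner_left[OF C1_fun_has_derivative[OF V], of b x]]
    by (metis (no_types))
  have z: "(\<integral>x. frechet_derivative V (at x) b \<bullet> b \<partial>lborel) = 0" for b
    using integral_frechet_derivative_eq_0[OF V' K(1), of b b] K(2) unfolding eq by simp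
  have c: "continuous_on UNIV (\<lambda>x. frechet_derivative V (at x) b \<bullet> b)" for b
    by (intro continuous_intros C1_fun_continuous_derivative V)
  have "integrable lebesgue (\<lambda>x. frechet_derivative V (at x) b \<bullet> b)" for b
    by (rule integrable_compact_support[OF c K(1)])
      (simp add: frechet_derivative_eq_0_outside_compact[OF K])
  then have i: "integrable lborel (\<lambda>x. frechet_derivative V (at x) b \<bullet> b)" for b
    using borel_measurable_continuous_onI[OF c] by (simp add: integrable_completion)
  have "(\<integral>x. divergence V x \<partial>lebesgue) = (\<integral>x. divergence V x \<partial>lborel)"
    using borel_measurable_continuous_onI[OF divergence_continuous[OF V]] by (intro integral_completion) simp
  also have "\<dots> = 0" unfolding divergence_def using i z by simp
  finally show ?thesis .
qed

text \<open>The sum over the basis replaces the operator norm: it bounds it and is visibly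
  continuous in \<open>x\<close>, hence integrable for a cutoff.\<close>

lemma abs_derivative_le:
  assumes "C1_fun (f :: 'a::euclidean_space \<Rightarrow> real)"
  shows "\<bar>frechet_derivative f (at x) v\<bar> \<le> norm v * (\<Sum>b\<in>Basis. \<bar>frechet_derivative f (at x) b\<bar>)"
proof -
  have lin: "linear (frechet_derivative f (at x))"
    using has_derivative_linear[OF C1_fun_has_derivative[OF assms]] .
  have "frechet_derivative f (at x) v = frechet_derivative f (at x) (\<Sum>b\<in>Basis. (v \<bullet> b) *\<^sub>R b)"
    by (simp add: euclidean_representation)
  also have "\<dots> = (\<Sum>b\<in>Basis. (v \<bullet> b) * frechet_derivative f (at x) b)"
    by (simp add: linear_sum[OF lin] linear_scale[OF lin])
  also have "\<bar>\<dots>\<bar> \<le> (\<Sum>b\<in>Basis. norm v * \<bar>frechet_derivative f (at x) b\<bar>)"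
    by (rule order_trans[OF sum_abs sum_mono]) (auto simp: abs_mult Basis_le_norm intro!: mult_right_mono)
  finally show ?thesis by (simp add: sum_distrib_left)
qed

section \<open>Subcalibrations\<close>

lemma divergence_eq_0_outside_compact:
  fixes V :: "'a::euclidean_space \<Rightarrow> 'a"
  assumes "compact K" "\<And>x. x \<notin> K \<Longrightarrow> V x = 0" "y \<notin> K"
  shows "divergence V y = 0"
  unfolding divergence_def using frechet_derivative_eq_0_outside_compact[OF assms] by simp

lemma integrable_divergence:
  fixes V :: "'a::euclidean_space \<Rightarrow> 'a"
  assumes "C1_fun V" "compact K" "\<And>x. x \<notin> K \<Longrightarrow> V x = 0"
  shows "integrable lebesgue (divergence V)"
  by (rule integrable_compact_support[OF divergence_continuous[OF assms(1)] assms(2)])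
    (rule divergence_eq_0_outside_compact[OF assms(2,3)])

text \<open>
  \<open>N\<close> is the gradient of \<open>G\<close>; the condition \<open>flux\<close> says that the \<open>\<xi> k\<close> tend to the unit normal of
  the level sets of \<open>G\<close>, with an error that stays bounded where \<open>N\<close> vanishes.
\<close>

locale subcalibration =
  fixes G :: "'a::euclidean_space \<Rightarrow> real" and N :: "'a \<Rightarrow> 'a"
    and \<xi> :: "nat \<Rightarrow> 'a \<Rightarrow> 'a" and \<mu> d :: "'a \<Rightarrow> real" and \<rho> :: "nat \<Rightarrow> real" and C :: real
  assumes G_deriv: "\<And>x. (G has_derivative (\<lambda>v. N x \<bullet> v)) (at x)"
    and N_cont: "continuous_on UNIV N"
    and xi_C1: "\<And>k. C1_fun (\<xi> k)"
    and xi_norm: "\<And>k x. norm (\<xi> k x) \<le> 1"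
    and xi_N: "\<And>k x. 0 \<le> N x \<bullet> \<xi> k x"
    and flux: "\<And>k x. norm (N x) - \<mu> x * \<rho> k \<le> N x \<bullet> \<xi> k x"
    and mu_cont: "continuous_on UNIV \<mu>"
    and rho: "\<rho> \<longlonglongrightarrow> 0"
    and div_neg: "\<And>k x. G x < 0 \<Longrightarrow> divergence (\<xi> k) x \<le> 0"
    and div_pos: "\<And>k x. G x \<ge> 0 \<Longrightarrow> divergence (\<xi> k) x \<ge> 0"
    and d_lim: "\<And>x. G x < 0 \<Longrightarrow> (\<lambda>k. divergence (\<xi> k) x) \<longlonglongrightarrow> d x"
    and d_dom: "\<And>k x. G x < 0 \<Longrightarrow> \<bar>divergence (\<xi> k) x\<bar> \<le> C * \<bar>d x\<bar>"
begin

definition E :: "'a set" where "E = {x. G x < 0}"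

text \<open>A differentiable approximation of the indicator of \<open>E\<close> from below, equal to
  1 where \<open>G x \<le> - \<delta>\<close> and to 0 off \<open>E\<close>.\<close>

definition eta :: "real \<Rightarrow> 'a \<Rightarrow> real" where
  "eta \<delta> x = step (- G x / \<delta>)"

text \<open>The weight in the gradient \<open>- kappa \<delta> x *\<^sub>R N x\<close> of
  \<open>eta\<close>. It is concentrated on the layer where \<open>G\<close> lies between
  \<open>- \<delta>\<close> and 0 and plays the part of surface measure.\<close>

definition kappa :: "real \<Rightarrow> 'a \<Rightarrow> real" where
  "kappa \<delta> x = step' (- G x / \<delta>) / \<delta>"

lemma G_cont: "continuous_on UNIV G"
  using has_derivative_continuous[OF G_deriv] by (intro continuous_at_imp_continuous_on) auto

lemma E_open: "open E"
  unfolding E_def using continuous_on_const[of UNIV 0] G_cont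
  by (intro open_Collect_less) auto

lemma E_sets: "E \<in> sets lebesgue"
  using E_open by simp

lemma G_C1: "C1_fun G"
  by (rule C1_funI[OF G_deriv]) (intro continuous_intros N_cont)

lemma eta_C1: "C1_fun (eta \<delta>)"
proof -
  have "C1_fun (\<lambda>x. step ((- 1 / \<delta>) * G x))"
    by (intro C1_fun_step C1_fun_mult C1_fun_const G_C1)
  then show ?thesis by (simp add: eta_def[abs_def])
qed

lemma eta_deriv: "(eta \<delta> has_derivative (\<lambda>v. - kappa \<delta> x * (N x \<bullet> v))) (at x)"
proof -
  have 1: "((\<lambda>x. (- 1 / \<delta>) * G x) has_derivative (\<lambda>v. (- 1 / \<delta>) * (N x \<bullet> v))) (at x)"
    by (rule has_derivative_mult_right[OF G_deriv])
  have "((\<lambda>x. step ((- 1 / \<delta>) * G x)) has_derivative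
      (\<lambda>v. step' ((- 1 / \<delta>) * G x) * ((- 1 / \<delta>) * (N x \<bullet> v)))) (at x)"
    by (rule has_derivative_compose[OF 1 step_deriv[unfolded has_field_derivative_def]])
  then show ?thesis by (simp add: eta_def[abs_def] kappa_def)
qed

lemma kappa_cont: "\<delta> > 0 \<Longrightarrow> continuous_on UNIV (kappa \<delta>)"
  unfolding kappa_def
  by (intro continuous_intros G_cont continuous_on_compose2[OF step'_continuous[of UNIV]]) auto

lemma kappa_nonneg: "\<delta> > 0 \<Longrightarrow> kappa \<delta> x \<ge> 0"
  unfolding kappa_def using step'_nonneg by simp

lemma eta_bounds: "0 \<le> eta \<delta> x" "eta \<delta> x \<le> 1"
  unfolding eta_def by (rule step_bounds)+

lemma eta_0: "\<delta> > 0 \<Longrightarrow> x \<notin> E \<Longrightarrow> eta \<delta> x = 0"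
  unfolding eta_def E_def by (intro step_eq_0) (auto simp: divide_nonpos_pos)

lemma eta_1: "\<delta> > 0 \<Longrightarrow> G x \<le> - \<delta> \<Longrightarrow> eta \<delta> x = 1"
  unfolding eta_def by (intro step_eq_1) (auto simp: field_simps)

text \<open>This is integration by parts: the field \<open>eta \<delta> x *\<^sub>R V x\<close> has
  compact support, so its divergence integrates to 0.\<close>

lemma integral_eta_divergence:
  assumes V: "C1_fun V" "compact K" "\<And>x. x \<notin> K \<Longrightarrow> V x = 0" and \<delta>: "\<delta> > 0"
  shows "integrable lebesgue (\<lambda>x. eta \<delta> x * divergence V x)"
    and "integrable lebesgue (\<lambda>x. kappa \<delta> x * (N x \<bullet> V x))"
    and "(\<integral>x. eta \<delta> x * divergence V x \<partial>lebesgue) = (\<integral>x. kappa \<delta> x * (N x \<bullet> V x) \<partial>lebesgue)"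
proof -
  show i1: "integrable lebesgue (\<lambda>x. eta \<delta> x * divergence V x)"
    by (rule integrable_compact_support[OF _ V(2)])
      (auto intro!: continuous_intros C1_fun_continuous[OF eta_C1] divergence_continuous V
        simp: divergence_eq_0_outside_compact[OF V(2,3)])
  show i2: "integrable lebesgue (\<lambda>x. kappa \<delta> x * (N x \<bullet> V x))"
    by (rule integrable_compact_support[OF _ V(2)])
      (auto intro!: continuous_intros kappa_cont N_cont C1_fun_continuous[OF V(1)] \<delta> simp: V(3))
  have "(\<integral>x. divergence (\<lambda>x. eta \<delta> x *\<^sub>R V x) x \<partial>lebesgue) = 0"
    by (rule integral_divergence_eq_0[OF _ V(2)]) (auto intro!: C1_fun_scaleR eta_C1 V)
  moreover have "divergence (\<lambda>x. eta \<delta> x *\<^sub>R V x) x = eta \<delta> x * divergence V x - kappa \<delta> x * (N x \<bullet> V x)" for x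
    using divergence_scaleR[OF eta_deriv V(1)] by simp
  ultimately show "(\<integral>x. eta \<delta> x * divergence V x \<partial>lebesgue) = (\<integral>x. kappa \<delta> x * (N x \<bullet> V x) \<partial>lebesgue)"
    using i1 i2 by simp
qed

text \<open>
  On \<open>E\<close> the divergences have one sign, so testing with a cutoff bounds their \<open>L\<^sup>1\<close> norms uniformly;
  Fatou's lemma passes the bound to the limit.
\<close>

lemma integrable_cutoff_limit_divergence:
  assumes chi: "C1_fun \<psi>" "compact L" "\<And>x. x \<notin> L \<Longrightarrow> \<psi> x = 0" "\<And>x. 0 \<le> \<psi> x"
  shows "integrable lebesgue (\<lambda>x. indicator E x * (\<psi> x * \<bar>d x\<bar>))"
proof -
  define g where "g x = (\<Sum>b\<in>Basis. \<bar>frechet_derivative \<psi> (at x) b\<bar>)" for x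
  have g_cont: "continuous_on UNIV g"
    unfolding g_def by (intro continuous_intros C1_fun_continuous_derivative chi)
  have g_int: "integrable lebesgue g"
    by (rule integrable_compact_support[OF g_cont chi(2)])
      (simp add: g_def frechet_derivative_eq_0_outside_compact[OF chi(2,3)])
  define \<delta> where "\<delta> k = 1 / real (Suc k)" for k
  have \<delta>: "\<delta> k > 0" for k by (simp add: \<delta>_def)
  define u where "u k x = eta (\<delta> k) x * (\<psi> x * \<bar>divergence (\<xi> k) x\<bar>)" for k x
  have u_nn: "u k x \<ge> 0" for k x unfolding u_def using eta_bounds chi by simp
  have u_int: "integrable lebesgue (u k)" for k
    unfolding u_def
    by (rule integrable_compact_support[OF _ chi(2)])
      (auto intro!: continuous_intros C1_fun_continuous[OF eta_C1] divergence_continuous C1_fun_continuous[OF chi(1)] xi_C1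
        simp: chi(3))
  have u_le: "(\<integral>x. u k x \<partial>lebesgue) \<le> (\<integral>x. g x \<partial>lebesgue)" for k
  proof -
    define V where "V x = \<psi> x *\<^sub>R \<xi> k x" for x
    have V: "C1_fun V" "\<And>x. x \<notin> L \<Longrightarrow> V x = 0"
      unfolding V_def by (auto intro!: C1_fun_scaleR chi xi_C1 simp: chi(3))
    note ii = integral_eta_divergence[OF V(1) chi(2) V(2) \<delta>[of k]]
    have "(\<integral>x. u k x \<partial>lebesgue) \<le> (\<integral>x. g x - eta (\<delta> k) x * divergence V x \<partial>lebesgue)"
    proof (rule integral_mono)
      show "integrable lebesgue (\<lambda>x. g x - eta (\<delta> k) x * divergence V x)"
        using g_int ii(1) by simp
      fix x
      have dV: "divergence V x = \<psi> x * divergence (\<xi> k) x + frechet_derivative \<psi> (at x) (\<xi> k x)"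
        unfolding V_def by (rule divergence_scaleR_C1[OF chi(1) xi_C1])
      have "\<bar>frechet_derivative \<psi> (at x) (\<xi> k x)\<bar> \<le> norm (\<xi> k x) * g x"
        unfolding g_def by (rule abs_derivative_le[OF chi(1)])
      also have "\<dots> \<le> g x" using xi_norm[of k x] unfolding g_def
        by (intro mult_left_le_one_le sum_nonneg) auto
      finally have b: "\<bar>frechet_derivative \<psi> (at x) (\<xi> k x)\<bar> \<le> g x" .
      have "eta (\<delta> k) x * frechet_derivative \<psi> (at x) (\<xi> k x) \<le> eta (\<delta> k) x * g x"
        using b eta_bounds by (intro mult_left_mono) auto
      also have "\<dots> \<le> g x"
        using eta_bounds b by (intro mult_left_le_one_le) auto
      finally have c: "eta (\<delta> k) x * frechet_derivative \<psi> (at x) (\<xi> k x) \<le> g x" .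
      \<comment> \<open>The sign condition \<open>div_neg\<close> removes the absolute value on
        \<open>E\<close>; elsewhere \<open>eta\<close> vanishes.\<close>
      have "eta (\<delta> k) x * (\<psi> x * \<bar>divergence (\<xi> k) x\<bar>) = - (eta (\<delta> k) x * (\<psi> x * divergence (\<xi> k) x))"
      proof (cases "x \<in> E")
        case True
        then show ?thesis using div_neg[of x k] by (simp add: E_def abs_of_nonpos)
      next
        case False
        then show ?thesis using eta_0[OF \<delta>] by simp
      qed
      then show "u k x \<le> g x - eta (\<delta> k) x * divergence V x"
        unfolding u_def dV using c by (simp add: algebra_simps)
    qed (rule u_int)
    also have "\<dots> = (\<integral>x. g x \<partial>lebesgue) - (\<integral>x. kappa (\<delta> k) x * (N x \<bullet> V x) \<partial>lebesgue)"
      using g_int ii by simp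
    also have "\<dots> \<le> (\<integral>x. g x \<partial>lebesgue)"
      unfolding V_def using kappa_nonneg[OF \<delta>] chi(4) xi_N
      by (auto intro!: integral_nonneg)
    finally show ?thesis .
  qed
  have u_lim: "(\<lambda>k. u k x) \<longlonglongrightarrow> indicator E x * (\<psi> x * \<bar>d x\<bar>)" for x
  proof (cases "x \<in> E")
    case True
    then have neg: "G x < 0" by (simp add: E_def)
    have "\<delta> \<longlonglongrightarrow> 0" unfolding \<delta>_def[abs_def] using LIMSEQ_inverse_real_of_nat by (simp add: inverse_eq_divide)
    then have "\<forall>\<^sub>F k in sequentially. \<delta> k < - G x" using neg by (intro order_tendstoD(2)) auto
    then have "\<forall>\<^sub>F k in sequentially. \<psi> x * \<bar>divergence (\<xi> k) x\<bar> = u k x"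
      by eventually_elim (simp add: u_def eta_1[OF \<delta>])
    moreover have "(\<lambda>k. \<psi> x * \<bar>divergence (\<xi> k) x\<bar>) \<longlonglongrightarrow> \<psi> x * \<bar>d x\<bar>"
      by (intro tendsto_intros d_lim neg)
    ultimately show ?thesis using True by (simp add: Lim_transform_eventually)
  next
    case False
    then show ?thesis using eta_0[OF \<delta>] by (simp add: u_def)
  qed
  let ?v = "\<lambda>x. indicator E x * (\<psi> x * \<bar>d x\<bar>)"
  have v_nn: "?v x \<ge> 0" for x using chi(4) by (auto simp: indicator_def)
  have v_meas: "?v \<in> borel_measurable lebesgue"
    by (rule borel_measurable_LIMSEQ_real[OF u_lim]) (use u_int in auto)
  have "(\<integral>\<^sup>+x. ennreal (?v x) \<partial>lebesgue) = (\<integral>\<^sup>+x. liminf (\<lambda>k. ennreal (u k x)) \<partial>lebesgue)"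
    using u_lim by (intro nn_integral_cong lim_imp_Liminf[symmetric] tendsto_ennrealI) auto
  also have "\<dots> \<le> liminf (\<lambda>k. \<integral>\<^sup>+x. ennreal (u k x) \<partial>lebesgue)"
    using u_int by (intro nn_integral_liminf) auto
  also have "\<dots> = liminf (\<lambda>k. ennreal (\<integral>x. u k x \<partial>lebesgue))"
    using u_int u_nn by (simp add: nn_integral_eq_integral)
  also have "\<dots> \<le> liminf (\<lambda>k::nat. ennreal (\<integral>x. g x \<partial>lebesgue))"
    by (intro Liminf_mono always_eventually allI ennreal_leI u_le)
  also have "\<dots> < \<infinity>" by (simp add: Liminf_const)
  finally show ?thesis
    using v_meas v_nn by (intro integrableI_nonneg) auto
qed

text \<open>
  This replaces the Gauss-Green formula on \<open>E\<close>: the indicator of \<open>E\<close> is approximated by functions of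
  \<open>G\<close>, and only then is \<open>k\<close> chosen, depending on the width of the transition layer.
\<close>

lemma cutoff_flux:
  assumes chi: "C1_fun \<psi>" "compact L" "\<And>x. x \<notin> L \<Longrightarrow> \<psi> x = 0" "\<And>x. 0 \<le> \<psi> x"
    and g: "C1_fun g" "\<And>x. norm (g x) \<le> 1" and \<epsilon>: "\<epsilon> > 0"
  obtains k where "- \<epsilon> \<le> (\<integral>x. indicator E x * divergence (\<lambda>x. \<psi> x *\<^sub>R (\<xi> k x - g x)) x \<partial>lebesgue)"
proof -
  define c where "c x = (\<Sum>b\<in>Basis. \<bar>frechet_derivative \<psi> (at x) b\<bar>)" for x
  have c_cont: "continuous_on UNIV c"
    unfolding c_def by (intro continuous_intros C1_fun_continuous_derivative chi)
  have c_int: "integrable lebesgue c"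
    by (rule integrable_compact_support[OF c_cont chi(2)])
      (simp add: c_def frechet_derivative_eq_0_outside_compact[OF chi(2,3)])
  define W where "W k x = \<psi> x *\<^sub>R (\<xi> k x - g x)" for k x
  have W: "C1_fun (W k)" "\<And>x. x \<notin> L \<Longrightarrow> W k x = 0" for k
    unfolding W_def by (auto intro!: C1_fun_scaleR C1_fun_diff chi xi_C1 g simp: chi(3))
  \<comment> \<open>A bound for the divergence of \<open>W k\<close> on \<open>E\<close> that does
    not depend on \<open>k\<close>. The factor 2 bounds
    \<open>norm (\<xi> k x - g x)\<close>.\<close>
  define P where "P x = C * (indicator E x * (\<psi> x * \<bar>d x\<bar>)) + indicator E x * (\<psi> x * \<bar>divergence g x\<bar> + 2 * c x)" for x
  have i1: "integrable lebesgue (\<lambda>x. \<psi> x * \<bar>divergence g x\<bar>)"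
    by (rule integrable_compact_support[OF _ chi(2)])
      (auto intro!: continuous_intros divergence_continuous C1_fun_continuous[OF chi(1)] g simp: chi(3))
  have P_int: "integrable lebesgue P"
    unfolding P_def
    using integrable_cutoff_limit_divergence[OF chi] integrable_mult_indicator[OF E_sets, of "\<lambda>x. \<psi> x * \<bar>divergence g x\<bar> + 2 * c x"]
      i1 c_int by (intro Bochner_Integration.integrable_add integrable_mult_right) auto
  have dW: "\<bar>divergence (W k) x\<bar> \<le> P x" if "x \<in> E" for k x
  proof -
    have "divergence (W k) x = \<psi> x * divergence (\<lambda>x. \<xi> k x - g x) x + frechet_derivative \<psi> (at x) (\<xi> k x - g x)"
      unfolding W_def by (rule divergence_scaleR_C1[OF chi(1) C1_fun_diff[OF xi_C1 g(1)]])
    moreover have "divergence (\<lambda>x. \<xi> k x - g x) x = divergence (\<xi> k) x - divergence g x"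
      using divergence_has_derivative[OF has_derivative_diff[OF C1_fun_has_derivative[OF xi_C1] C1_fun_has_derivative[OF g(1)]]]
      by (simp add: divergence_def inner_diff_left sum_subtractf)
    ultimately have eq: "divergence (W k) x = \<psi> x * (divergence (\<xi> k) x - divergence g x) + frechet_derivative \<psi> (at x) (\<xi> k x - g x)"
      by simp
    have "\<bar>frechet_derivative \<psi> (at x) (\<xi> k x - g x)\<bar> \<le> norm (\<xi> k x - g x) * c x"
      unfolding c_def by (rule abs_derivative_le[OF chi(1)])
    also have "\<dots> \<le> 2 * c x"
      using norm_triangle_ineq4[of "\<xi> k x" "g x"] xi_norm[of k x] g(2)[of x]
      by (intro mult_right_mono) (auto simp: c_def sum_nonneg)
    finally have 1: "\<bar>frechet_derivative \<psi> (at x) (\<xi> k x - g x)\<bar> \<le> 2 * c x" .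
    have 2: "\<bar>\<psi> x * divergence (\<xi> k) x\<bar> \<le> \<psi> x * (C * \<bar>d x\<bar>)"
      using d_dom[of x k] chi(4)[of x] that by (auto simp: abs_mult E_def intro!: mult_left_mono)
    have 3: "\<bar>\<psi> x * divergence g x\<bar> \<le> \<psi> x * \<bar>divergence g x\<bar>"
      using chi(4)[of x] by (simp add: abs_mult)
    show ?thesis using 1 2 3 that unfolding eq P_def right_diff_distrib by (simp add: mult.left_commute)
  qed
  have P_nn: "P x \<ge> 0" for x
    using dW[of x 0] by (cases "x \<in> E") (auto simp: P_def)
  define \<delta> where "\<delta> j = 1 / real (Suc j)" for j
  have \<delta>: "\<delta> j > 0" for j by (simp add: \<delta>_def)
  have \<delta>_lim: "\<delta> \<longlonglongrightarrow> 0" unfolding \<delta>_def[abs_def] using LIMSEQ_inverse_real_of_nat by (simp add: inverse_eq_divide)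
  have band_sets: "{x. - \<delta> j < G x} \<in> sets lebesgue" for j
    using open_Collect_less[OF continuous_on_const G_cont] by simp
  have band_int: "integrable lebesgue (\<lambda>x. indicator {x. - \<delta> j < G x} x * P x)" for j
    using integrable_mult_indicator[OF band_sets P_int, of j] by simp
  \<comment> \<open>The parts of the bands inside \<open>E\<close> shrink to the empty set and
    \<open>P\<close> vanishes off \<open>E\<close>, so half of \<open>\<epsilon>\<close> pays for
    replacing \<open>eta\<close> by the indicator of \<open>E\<close>.\<close>
  have "(\<lambda>j. \<integral>x. indicator {x. - \<delta> j < G x} x * P x \<partial>lebesgue) \<longlonglongrightarrow> (\<integral>x. 0 \<partial>(lebesgue :: 'a measure))"
  proof (rule integral_dominated_convergence[where w=P])
    show "AE x in lebesgue. (\<lambda>j. indicator {x. - \<delta> j < G x} x * P x) \<longlonglongrightarrow> 0"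
    proof (rule AE_I2)
      fix x
      show "(\<lambda>j. indicator {x. - \<delta> j < G x} x * P x) \<longlonglongrightarrow> 0"
      proof (cases "x \<in> E")
        case True
        then have "\<forall>\<^sub>F j in sequentially. \<delta> j < - G x"
          using \<delta>_lim by (intro order_tendstoD(2)) (auto simp: E_def)
        then have "\<forall>\<^sub>F j in sequentially. indicator {x. - \<delta> j < G x} x * P x = 0"
          by eventually_elim auto
        then show ?thesis by (rule tendsto_eventually)
      next
        case False
        then show ?thesis by (simp add: P_def)
      qed
    qed
    show "AE x in lebesgue. norm (indicator {x. - \<delta> j < G x} x * P x) \<le> P x" for j
      using P_nn by (intro AE_I2) (auto simp: indicator_def)
  qed (use P_int band_int in auto)
  then have "\<forall>\<^sub>F j in sequentially. (\<integral>x. indicator {x. - \<delta> j < G x} x * P x \<partial>lebesgue) < \<epsilon> / 2"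
    using \<epsilon> by (intro order_tendstoD(2)) auto
  then obtain j where j: "(\<integral>x. indicator {x. - \<delta> j < G x} x * P x \<partial>lebesgue) < \<epsilon> / 2"
    by (meson eventually_sequentially order_refl)
  \<comment> \<open>With \<open>j\<close> fixed, \<open>M\<close> is a fixed number, and a large
    \<open>k\<close> pushes the flux error \<open>\<rho> k * M\<close> below the other half of
    \<open>\<epsilon>\<close>.\<close>
  define M where "M = (\<integral>x. kappa (\<delta> j) x * (\<psi> x * \<mu> x) \<partial>lebesgue)"
  have M_int: "integrable lebesgue (\<lambda>x. kappa (\<delta> j) x * (\<psi> x * \<mu> x))"
    by (rule integrable_compact_support[OF _ chi(2)])
      (auto intro!: continuous_intros kappa_cont \<delta> mu_cont C1_fun_continuous[OF chi(1)] simp: chi(3))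
  have "(\<lambda>k. \<rho> k * M) \<longlonglongrightarrow> 0 * M" by (intro tendsto_intros rho)
  then have "\<forall>\<^sub>F k in sequentially. \<rho> k * M < \<epsilon> / 2"
    using \<epsilon> by (intro order_tendstoD(2)) auto
  then obtain k where k: "\<rho> k * M < \<epsilon> / 2" by (meson eventually_sequentially order_refl)
  note ii = integral_eta_divergence[OF W(1) chi(2) W(2) \<delta>[of j], of k]
  have "- (\<rho> k * M) = (\<integral>x. - \<rho> k * (kappa (\<delta> j) x * (\<psi> x * \<mu> x)) \<partial>lebesgue)"
    unfolding M_def by simp
  also have "\<dots> \<le> (\<integral>x. kappa (\<delta> j) x * (N x \<bullet> W k x) \<partial>lebesgue)"
  proof (rule integral_mono[OF _ ii(2)])
    fix x
    have "N x \<bullet> g x \<le> norm (N x) * norm (g x)" by (rule norm_cauchy_schwarz)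
    also have "\<dots> \<le> norm (N x)" using g(2)[of x] by (simp add: mult_left_le)
    finally have "- (\<rho> k * \<mu> x) \<le> N x \<bullet> (\<xi> k x - g x)"
      using flux[of x k] by (simp add: inner_diff_right mult.commute)
    then have "(kappa (\<delta> j) x * \<psi> x) * - (\<rho> k * \<mu> x) \<le> (kappa (\<delta> j) x * \<psi> x) * (N x \<bullet> (\<xi> k x - g x))"
      using kappa_nonneg[OF \<delta>] chi(4) by (intro mult_left_mono) auto
    then show "- \<rho> k * (kappa (\<delta> j) x * (\<psi> x * \<mu> x)) \<le> kappa (\<delta> j) x * (N x \<bullet> W k x)"
      unfolding W_def by (simp add: algebra_simps)
  qed (use M_int in auto)
  also have "\<dots> = (\<integral>x. eta (\<delta> j) x * divergence (W k) x \<partial>lebesgue)" using ii(3) by simp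
  finally have 1: "- (\<epsilon> / 2) \<le> (\<integral>x. eta (\<delta> j) x * divergence (W k) x \<partial>lebesgue)" using k by simp
  have EW_int: "integrable lebesgue (\<lambda>x. indicator E x * divergence (W k) x)"
    using integrable_mult_indicator[OF E_sets integrable_divergence[OF W(1) chi(2) W(2)]] by simp
  \<comment> \<open>\<open>eta\<close> and the indicator of \<open>E\<close> differ only in the
    band, by at most 1, so the exchange costs at most \<open>P\<close> there.\<close>
  have "(\<integral>x. eta (\<delta> j) x * divergence (W k) x - indicator {x. - \<delta> j < G x} x * P x \<partial>lebesgue)
      \<le> (\<integral>x. indicator E x * divergence (W k) x \<partial>lebesgue)"
  proof (rule integral_mono[OF _ EW_int])
    fix x
    show "eta (\<delta> j) x * divergence (W k) x - indicator {x. - \<delta> j < G x} x * P x \<le> indicator E x * divergence (W k) x"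
    proof (cases "x \<in> E")
      case False
      then show ?thesis using eta_0[OF \<delta>] P_nn by (simp add: P_def)
    next
      case True
      show ?thesis
      proof (cases "- \<delta> j < G x")
        case False
        then show ?thesis using True eta_1[OF \<delta>] by simp
      next
        case b: True
        have "(eta (\<delta> j) x - 1) * divergence (W k) x \<le> \<bar>eta (\<delta> j) x - 1\<bar> * \<bar>divergence (W k) x\<bar>"
          by (metis abs_ge_self abs_mult)
        also have "\<dots> \<le> 1 * P x"
          using eta_bounds[of "\<delta> j" x] dW[OF True] by (intro mult_mono) auto
        finally show ?thesis using True b by (simp add: algebra_simps)
      qed
    qed
  qed (use ii(1) band_int in auto)
  then have "- \<epsilon> \<le> (\<integral>x. indicator E x * divergence (W k) x \<partial>lebesgue)"
    using 1 j ii(1) band_int by simp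
  then show thesis using that unfolding W_def by blast
qed

text \<open>Replacing \<open>g\<close> by the interpolated field \<open>h\<close> loses at most
  \<open>\<epsilon>\<close> on \<open>E\<close>, by \<open>cutoff_flux\<close>. Passing from
  \<open>E\<close> to \<open>F\<close> does not lower the integral of the divergence of
  \<open>h\<close>, because of its sign on the symmetric difference.\<close>

lemma minimal: "minimal_in E UNIV"
  unfolding minimal_in_def
proof (intro conjI allI impI)
  show "open E" by (rule E_open)
  fix A F :: "'a set"
  assume "open A \<and> bounded A \<and> A \<subseteq> UNIV \<and> F \<in> sets lebesgue \<and> F \<subseteq> UNIV \<and>
        compact (closure (F \<union> E - F \<inter> E)) \<and> closure (F \<union> E - F \<inter> E) \<subseteq> A"
  then have A: "open A" and F: "F \<in> sets lebesgue"
    and K: "compact (closure (F \<union> E - F \<inter> E))" "closure (F \<union> E - F \<inter> E) \<subseteq> A" by auto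
  obtain \<psi> L where psi: "C1_fun \<psi>" "compact L" "L \<subseteq> A" "\<And>x. x \<notin> L \<Longrightarrow> \<psi> x = (0::real)"
    "\<And>x. x \<in> closure (F \<union> E - F \<inter> E) \<Longrightarrow> \<psi> x = 1" "\<And>x. 0 \<le> \<psi> x" "\<And>x. \<psi> x \<le> 1"
    using C1_cutoff[OF K(1) A K(2)] by blast
  \<comment> \<open>Intersecting with \<open>A\<close> changes nothing, since the divergence of a
    test field vanishes off its support.\<close>
  have restrict: "(LINT x:S \<inter> A|lebesgue. divergence g x) = (\<integral>x. indicator S x * divergence g x \<partial>lebesgue)"
    if "g \<in> C1c A" for S g
    unfolding set_lebesgue_integral_def
  proof (rule Bochner_Integration.integral_cong[OF refl])
    fix x
    show "indicator (S \<inter> A) x *\<^sub>R divergence g x = indicator S x * divergence g x"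
      using divergence_outside_support[of x g] C1c_support(2)[OF that] by (cases "x \<in> A") (auto simp: indicator_def)
  qed
  have "ereal (LINT x:E \<inter> A|lebesgue. divergence g x) \<le> perimeter (F \<inter> A) (UNIV \<inter> A)"
    if g: "g \<in> C1c (UNIV \<inter> A)" "\<forall>x. norm (g x) \<le> 1" for g
  proof (rule ereal_le_epsilon2)
    fix \<epsilon> :: real assume \<epsilon>: "0 < \<epsilon>"
    have gA: "g \<in> C1c A" using g(1) by simp
    have gC1: "C1_fun g" by (rule C1c_C1_fun[OF gA])
    obtain k where k: "- \<epsilon> \<le> (\<integral>x. indicator E x * divergence (\<lambda>x. \<psi> x *\<^sub>R (\<xi> k x - g x)) x \<partial>lebesgue)"
      using cutoff_flux[OF psi(1,2,4,6) gC1 _ \<epsilon>] g(2) by blast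
    define W where "W x = \<psi> x *\<^sub>R (\<xi> k x - g x)" for x
    define h where "h x = g x + W x" for x
    have W: "C1_fun W" "\<And>x. x \<notin> L \<Longrightarrow> W x = 0"
      unfolding W_def by (auto intro!: C1_fun_scaleR C1_fun_diff psi(1) xi_C1 gC1 simp: psi(4))
    have h: "C1_fun h" unfolding h_def[abs_def] by (intro C1_fun_add gC1 W)
    define K' where "K' = closure {x. g x \<noteq> 0} \<union> L"
    have K': "compact K'" "K' \<subseteq> A" unfolding K'_def using C1c_support[OF gA] psi by auto
    have h0: "h x = 0" if "x \<notin> K'" for x
      using that closure_subset[of "{x. g x \<noteq> 0}"] W(2) unfolding K'_def h_def by auto
    have hA: "h \<in> C1c A" by (rule C1cI[OF h K' h0])
    have hn: "norm (h x) \<le> 1" for x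
    proof -
      \<comment> \<open>A pointwise convex combination of two vectors of norm at most 1.\<close>
      have "h x = (1 - \<psi> x) *\<^sub>R g x + \<psi> x *\<^sub>R \<xi> k x" unfolding h_def W_def by (simp add: algebra_simps)
      then have "norm (h x) \<le> (1 - \<psi> x) * norm (g x) + \<psi> x * norm (\<xi> k x)"
        using norm_triangle_ineq[of "(1 - \<psi> x) *\<^sub>R g x" "\<psi> x *\<^sub>R \<xi> k x"] psi(6,7)[of x] by simp
      also have "\<dots> \<le> (1 - \<psi> x) * 1 + \<psi> x * 1"
        using psi(6,7)[of x] g(2) xi_norm by (intro add_mono mult_left_mono) auto
      finally show ?thesis by simp
    qed
    have ig: "integrable lebesgue (divergence g)"
      by (rule integrable_divergence[OF gC1 C1c_support(1)[OF gA]]) (use closure_subset[of "{x. g x \<noteq> 0}"] in auto)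
    have iW: "integrable lebesgue (divergence W)" by (rule integrable_divergence[OF W(1) psi(2) W(2)])
    have ih: "integrable lebesgue (divergence h)" by (rule integrable_divergence[OF h K'(1) h0])
    have ind: "integrable lebesgue (\<lambda>x. indicator S x * f x)" if "integrable lebesgue f" "S \<in> sets lebesgue"
      for S and f :: "'a \<Rightarrow> real"
      using integrable_mult_indicator[OF that(2,1)] by simp
    have dh: "divergence h x = divergence g x + divergence W x" for x
      unfolding h_def[abs_def] by (rule divergence_add[OF gC1 W(1)])
    have dxi: "divergence h x = divergence (\<xi> k) x" if x: "x \<in> F \<union> E - F \<inter> E" for x
    proof -
      \<comment> \<open>the cutoff attains its maximum at \<open>x\<close>, so its derivative vanishes there\<close>
      have one: "\<psi> x = 1" by (rule psi(5)[OF subsetD[OF closure_subset x]])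
      have "frechet_derivative \<psi> (at x) = (\<lambda>v. 0)"
        by (rule differential_zero_maxmin[OF _ _ C1_fun_has_derivative[OF psi(1)], where S=UNIV]) (use psi(7) one in auto)
      moreover have "divergence (\<lambda>x. \<xi> k x - g x) x = divergence (\<xi> k) x - divergence g x"
        using divergence_has_derivative[OF has_derivative_diff[OF C1_fun_has_derivative[OF xi_C1] C1_fun_has_derivative[OF gC1]]]
        by (simp add: divergence_def inner_diff_left sum_subtractf)
      ultimately have "divergence W x = divergence (\<xi> k) x - divergence g x"
        unfolding W_def[abs_def] using divergence_scaleR_C1[OF psi(1) C1_fun_diff[OF xi_C1 gC1]] one by simp
      then show ?thesis using dh by simp
    qed
    have "(\<integral>x. indicator E x * divergence h x \<partial>lebesgue) \<le> (\<integral>x. indicator F x * divergence h x \<partial>lebesgue)"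
    proof (rule integral_mono[OF ind[OF ih E_sets] ind[OF ih F]])
      fix x
      \<comment> \<open>Where the indicators differ, the divergence of \<open>h\<close> is that of
        \<open>\<xi> k\<close>: nonpositive on \<open>E - F\<close>, nonnegative on
        \<open>F - E\<close>.\<close>
      show "indicator E x * divergence h x \<le> indicator F x * divergence h x"
        using dxi[of x] div_neg[of x k] div_pos[of x k] by (auto simp: indicator_def E_def)
    qed
    moreover have "(\<integral>x. indicator E x * divergence h x \<partial>lebesgue) =
        (\<integral>x. indicator E x * divergence g x \<partial>lebesgue) + (\<integral>x. indicator E x * divergence W x \<partial>lebesgue)"
      unfolding dh distrib_left
      by (rule Bochner_Integration.integral_add[OF ind[OF ig E_sets] ind[OF iW E_sets]])
    ultimately have "(\<integral>x. indicator E x * divergence g x \<partial>lebesgue) \<le> (\<integral>x. indicator F x * divergence h x \<partial>lebesgue) + \<epsilon>"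
      using k unfolding W_def[abs_def] by simp
    then have "ereal (LINT x:E \<inter> A|lebesgue. divergence g x) \<le> ereal (LINT x:F \<inter> A|lebesgue. divergence h x) + ereal \<epsilon>"
      unfolding restrict[OF gA] restrict[OF hA] by simp
    also have "\<dots> \<le> perimeter (F \<inter> A) (UNIV \<inter> A) + ereal \<epsilon>"
      unfolding perimeter_def using hA hn by (intro add_right_mono SUP_upper) auto
    finally show "ereal (LINT x:E \<inter> A|lebesgue. divergence g x) \<le> perimeter (F \<inter> A) (UNIV \<inter> A) + ereal \<epsilon>" .
  qed
  then show "perimeter (E \<inter> A) (UNIV \<inter> A) \<le> perimeter (F \<inter> A) (UNIV \<inter> A)"
    by (subst perimeter_def) (intro SUP_least, auto)
qed auto

end

section \<open>Quadratic forms of a Clifford system\<close>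

lemma divergence_id: "divergence (\<lambda>x. x) (x :: 'a::euclidean_space) = DIM('a)"
  using divergence_has_derivative[OF has_derivative_ident[of "at x"]] by (simp add: inner_Basis)

lemma divergence_matrix: "divergence (\<lambda>x. B *v x) (x :: real ^ 'm) = trace B"
proof -
  have "divergence (\<lambda>x. B *v x) x = (\<Sum>b\<in>Basis. (B *v b) \<bullet> b)"
    by (rule divergence_has_derivative) (rule bounded_linear_imp_has_derivative, simp)
  also have "\<dots> = (\<Sum>i\<in>UNIV. (B *v axis i 1) \<bullet> axis i 1)"
    unfolding Basis_vec_def using inj_on_def[of "\<lambda>i. axis i (1::real)" "UNIV :: 'm set"]
    by (simp add: UNION_singleton_eq_range sum.reindex axis_eq_axis)
  also have "\<dots> = trace B"
    by (simp add: trace_def inner_axis matrix_vector_mul_component)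
  finally show ?thesis .
qed

lemma matrix_minus_right: "B ** (- C) = - (B ** C)" for B C :: "real ^ 'm ^ 'm"
  by (simp add: matrix_matrix_mult_def vec_eq_iff sum_negf)

text \<open>The index set is arbitrary, so that both halves of the system are handled as subsets of
  it.\<close>

locale clifford =
  fixes A :: "nat \<Rightarrow> real ^ 'm ^ 'm" and I :: "nat set"
  assumes symmetric: "\<And>i. i \<in> I \<Longrightarrow> transpose (A i) = A i"
    and anticommute: "\<And>i j. i \<in> I \<Longrightarrow> j \<in> I \<Longrightarrow>
      A i ** A j + A j ** A i = (if i = j then 2 else 0) *\<^sub>R mat 1"
begin

definition form :: "nat \<Rightarrow> real ^ 'm \<Rightarrow> real" where
  "form i x = x \<bullet> (A i *v x)"

definition quartic :: "nat set \<Rightarrow> real ^ 'm \<Rightarrow> real" where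
  "quartic J x = (\<Sum>i\<in>J. (form i x)\<^sup>2)"

text \<open>For \<open>J \<subseteq> I\<close> this is a quarter of the gradient of
  \<open>quartic J\<close>.\<close>

definition grad :: "nat set \<Rightarrow> real ^ 'm \<Rightarrow> real ^ 'm" where
  "grad J x = (\<Sum>i\<in>J. form i x *\<^sub>R (A i *v x))"

lemma adjoint: "i \<in> I \<Longrightarrow> (A i *v x) \<bullet> y = x \<bullet> (A i *v y)"
  using dot_lmul_matrix[of x "A i" y] symmetric[of i] by (metis transpose_matrix_vector)

lemma involution: "i \<in> I \<Longrightarrow> A i *v (A i *v x) = x"
proof -
  assume i: "i \<in> I"
  have "(A i ** A i + A i ** A i) *v x = (2 *\<^sub>R mat 1) *v x" using anticommute[OF i i] by simp
  then have "2 *\<^sub>R (A i *v (A i *v x)) = 2 *\<^sub>R x"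
    by (simp only: matrix_vector_mult_add_rdistrib matrix_vector_mul_assoc scaleR_matrix_vector_assoc[symmetric]
        scaleR_2 matrix_vector_mul_lid)
  then show ?thesis by simp
qed

lemma anticommute_vec: "i \<in> I \<Longrightarrow> j \<in> I \<Longrightarrow> i \<noteq> j \<Longrightarrow> A i *v (A j *v x) = - (A j *v (A i *v x))"
proof -
  assume ij: "i \<in> I" "j \<in> I" "i \<noteq> j"
  have "(A i ** A j + A j ** A i) *v x = 0" using anticommute[OF ij(1,2)] ij(3) by simp
  then show ?thesis
    by (simp add: matrix_vector_mult_add_rdistrib matrix_vector_mul_assoc eq_neg_iff_add_eq_0)
qed

text \<open>For distinct indices the product of two anticommuting symmetric matrices is
  skew-symmetric; for equal ones \<open>A i\<close> is an isometry.\<close>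

lemma orthogonal: "i \<in> I \<Longrightarrow> j \<in> I \<Longrightarrow> (A i *v x) \<bullet> (A j *v x) = (if i = j then x \<bullet> x else 0)"
proof -
  assume ij: "i \<in> I" "j \<in> I"
  show ?thesis
  proof (cases "i = j")
    case True
    then show ?thesis using adjoint[OF ij(1), of x "A i *v x"] involution[OF ij(1)] by simp
  next
    case False
    have "(A i *v x) \<bullet> (A j *v x) = x \<bullet> (A i *v (A j *v x))" using adjoint ij by simp
    also have "\<dots> = - (x \<bullet> (A j *v (A i *v x)))" using anticommute_vec[OF ij False] by simp
    also have "\<dots> = - ((A i *v x) \<bullet> (A j *v x))"
      using adjoint[OF ij(2), of x "A i *v x"] by (simp add: inner_commute)
    finally show ?thesis using False by simp
  qed
qed

text \<open>Conjugation by the involution \<open>A j\<close> turns \<open>A i\<close> into its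
  negative and preserves the trace. This is why the quadratic forms are harmonic.\<close>

lemma trace_eq_0:
  assumes "i \<in> I" "j \<in> I" "i \<noteq> j"
  shows "trace (A i) = 0"
proof -
  have 1: "A j ** (A j ** A i) = A i"
    using involution[OF assms(2)]
    by (simp add: matrix_eq matrix_vector_mul_assoc[symmetric])
  have "A i ** A j = - (A j ** A i)"
    using anticommute[OF assms(1,2)] assms(3) by (simp add: eq_neg_iff_add_eq_0)
  then have "trace ((A j ** A i) ** A j) = trace (- (A j ** (A j ** A i)))"
    by (simp add: matrix_mul_assoc[symmetric] matrix_minus_right)
  also have "\<dots> = - trace (A i)" unfolding 1 by (simp add: trace_def sum_negf)
  finally show ?thesis using trace_mul_sym[of "A j ** A i" "A j"] 1 by simp
qed

lemma form_deriv: "i \<in> I \<Longrightarrow> (form i has_derivative (\<lambda>v. 2 * ((A i *v x) \<bullet> v))) (at x)"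
proof -
  assume i: "i \<in> I"
  have "(form i has_derivative (\<lambda>v. x \<bullet> (A i *v v) + v \<bullet> (A i *v x))) (at x)"
    unfolding form_def[abs_def]
    by (intro has_derivative_inner has_derivative_ident bounded_linear_imp_has_derivative matrix_vector_mul_bounded_linear)
  then show ?thesis using adjoint[OF i, of x] by (simp add: inner_commute)
qed

lemma form_C1: "C1_fun (form i)"
  unfolding form_def[abs_def] by (intro C1_fun_inner C1_fun_id C1_fun_bounded_linear) simp

lemma quartic_C1: "C1_fun (quartic J)"
  unfolding quartic_def[abs_def] by (intro C1_fun_sum C1_fun_power form_C1)

lemma grad_C1: "C1_fun (grad J)"
  unfolding grad_def[abs_def] by (intro C1_fun_sum C1_fun_scaleR form_C1 C1_fun_bounded_linear) simp

lemma quartic_deriv: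
  assumes "J \<subseteq> I"
  shows "(quartic J has_derivative (\<lambda>v. 4 * (grad J x \<bullet> v))) (at x)"
proof -
  have "(quartic J has_derivative (\<lambda>v. \<Sum>i\<in>J. 2 * (2 * ((A i *v x) \<bullet> v)) * form i x)) (at x)"
    unfolding quartic_def[abs_def]
    using assms by (intro has_derivative_sum) (auto intro!: derivative_eq_intros form_deriv)
  moreover have "(\<Sum>i\<in>J. 2 * (2 * ((A i *v x) \<bullet> v)) * form i x) = 4 * (grad J x \<bullet> v)" for v
    by (simp add: grad_def inner_sum_left sum_distrib_left mult_ac)
  ultimately show ?thesis by simp
qed

lemma quartic_nonneg: "quartic J x \<ge> 0"
  unfolding quartic_def by (intro sum_nonneg) auto

lemma grad_inner_self: "grad J x \<bullet> x = quartic J x"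
  unfolding grad_def quartic_def inner_sum_left
  by (simp add: form_def power2_eq_square inner_commute[of _ x])

text \<open>Orthogonality of the vectors \<open>A i *v x\<close> leaves only the terms with a common
  index.\<close>

lemma grad_inner_grad:
  assumes "J \<subseteq> I" "J' \<subseteq> I" "finite J"  "finite J'"
  shows "grad J x \<bullet> grad J' x = (x \<bullet> x) * quartic (J \<inter> J') x"
proof -
  have "grad J x \<bullet> grad J' x = (\<Sum>i\<in>J. \<Sum>j\<in>J'. form i x * form j x * ((A i *v x) \<bullet> (A j *v x)))"
    unfolding grad_def inner_sum_left
    by (intro sum.cong refl) (simp add: inner_sum_right sum_distrib_left mult.assoc mult.left_commute)
  also have "\<dots> = (\<Sum>i\<in>J. \<Sum>j\<in>J'. if j = i then (form i x)\<^sup>2 * (x \<bullet> x) else 0)"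
    using assms by (intro sum.cong refl) (auto simp: orthogonal subset_iff power2_eq_square)
  also have "\<dots> = (\<Sum>i\<in>J. if i \<in> J' then (form i x)\<^sup>2 * (x \<bullet> x) else 0)"
    using assms by simp
  also have "\<dots> = (x \<bullet> x) * quartic (J \<inter> J') x"
    using assms by (simp add: quartic_def sum.inter_restrict sum_distrib_left mult.commute if_distrib cong: if_cong)
  finally show ?thesis .
qed

text \<open>In each summand the trace term vanishes, and differentiating the coefficient contributes
  twice the squared norm of \<open>A i *v x\<close>.\<close>

lemma divergence_grad:
  assumes J: "J \<subseteq> I" and nontrivial: "\<And>i. i \<in> J \<Longrightarrow> \<exists>j\<in>I. j \<noteq> i"
  shows "divergence (grad J) x = 2 * card J * (x \<bullet> x)"
proof -
  have "divergence (grad J) x = (\<Sum>i\<in>J. divergence (\<lambda>x. form i x *\<^sub>R (A i *v x)) x)"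
    unfolding grad_def[abs_def]
    by (intro divergence_sum C1_fun_scaleR form_C1 C1_fun_bounded_linear) simp
  also have "\<dots> = (\<Sum>i\<in>J. 2 * (x \<bullet> x))"
  proof (rule sum.cong[OF refl])
    fix i assume i: "i \<in> J"
    have "divergence (\<lambda>x. form i x *\<^sub>R (A i *v x)) x = form i x * divergence (\<lambda>x. A i *v x) x + 2 * ((A i *v x) \<bullet> (A i *v x))"
      by (rule divergence_scaleR) (use i J in \<open>auto intro!: form_deriv C1_fun_bounded_linear\<close>)
    then show "divergence (\<lambda>x. form i x *\<^sub>R (A i *v x)) x = 2 * (x \<bullet> x)"
      using trace_eq_0[of i] nontrivial[OF i] i J by (auto simp: divergence_matrix orthogonal subset_iff)
  qed
  finally show ?thesis by simp
qed

lemma quartic_scaleR: "quartic J (h *\<^sub>R x) = h ^ 4 * quartic J x"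
proof -
  have "form i (h *\<^sub>R x) = h\<^sup>2 * form i x" for i
    by (simp add: form_def matrix_vector_mult_scaleR power2_eq_square)
  then show ?thesis by (simp add: quartic_def sum_distrib_left power_mult_distrib)
qed

end

section \<open>Scalar inequalities for the subcalibration\<close>

text \<open>To be read with \<open>T = t\<^sup>2\<close> and \<open>w = D\<^sup>2\<close>. The
  numbers 104 and 140 are \<open>16 * n + 40\<close> at \<open>n = 4\<close> and
  \<open>3 * m + 44\<close> at dimension \<open>m = 32\<close>. The factor 99/100 keeps a reserve
  that makes the regularisation controllable.\<close>

lemma subcalibration_inequality:
  fixes T s w \<delta> :: real
  assumes "0 \<le> T" "0 \<le> s" "0 \<le> w" "w \<le> s\<^sup>2" "104 * T + 140 * s \<le> \<delta>"
  defines "P \<equiv> 36 * T * s\<^sup>2 + 64 * T * w + 69 * w * s"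
  defines "Z \<equiv> (108 * s\<^sup>2 * T + 64 * T * w + 138 * s * w) * (40 * T + 12 * s)
      + (128 * T + 138 * s) * (24 * T * s\<^sup>2 + 16 * T * w + 12 * w * s)
      + 26 * (108 * s ^ 3 * T + 192 * T * s * w + 69 * s\<^sup>2 * w)"
  shows "Z / 2 \<le> (99 / 100) * (\<delta> * P)"
proof -
  define u where "u = s\<^sup>2 - w"
  have u: "u \<ge> 0" "s\<^sup>2 = u + w" using assms unfolding u_def by auto
  have P: "P = 36 * T * u + 100 * T * w + 69 * w * s" unfolding P_def u(2) by (simp add: algebra_simps)
  have P0: "P \<ge> 0" unfolding P using assms u by simp
  \<comment> \<open>After substituting \<open>s\<^sup>2 = u + w\<close> all coefficients are
    positive. The one of \<open>T\<^sup>2 * u\<close> leaves little room for a factor below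
    99/100.\<close>
  have "(99 / 50) * ((104 * T + 140 * s) * P) - Z =
      (21 + 3 / 25) * (T\<^sup>2 * u) + 8592 * (T\<^sup>2 * w) + (2563 + 1 / 5) * (T * s * u)
      + (19488 + 12 / 25) * (T * s * w) + (14020 + 4 / 5) * (s * s * w)"
    unfolding P_def Z_def u_def by (simp add: field_simps power2_eq_square power3_eq_cube)
  also have "\<dots> \<ge> 0" using assms(1-3) u(1) by (intro add_nonneg_nonneg mult_nonneg_nonneg) auto
  finally have "Z \<le> (99 / 50) * ((104 * T + 140 * s) * P)" by simp
  also have "\<dots> \<le> (99 / 50) * (\<delta> * P)" using assms(5) P0 by (intro mult_left_mono mult_right_mono) auto
  finally show ?thesis by simp
qed

text \<open>In the application \<open>S\<close> is the squared norm of \<open>Y\<close>,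
  \<open>e\<close> the regularisation, \<open>x\<close> is \<open>M\<close> and \<open>y\<close> is
  \<open>delta\<close>. The last hypothesis bounds the numerator by
  \<open>100 * x * (S + e) / S\<close>, and one factor \<open>S + e\<close> cancels.\<close>

lemma regularisation_bound:
  fixes S e x y :: real
  assumes "S > 0" "e \<ge> 0" "x \<ge> 0" "y * S \<le> 100 * x"
  shows "(x + e * y) / sqrt (S + e) ^ 3 \<le> 100 * (x / sqrt S ^ 3)"
proof -
  have cube: "sqrt r ^ 3 = r * sqrt r" if "r > 0" for r :: real
    using that by (simp add: power3_eq_cube)
  have "y \<le> 100 * x / S" using assms by (simp add: field_simps)
  then have "e * y \<le> e * (100 * x / S)" using assms(2) by (rule mult_left_mono)
  moreover have "x \<le> 100 * x" using assms by simp
  ultimately have "x + e * y \<le> 100 * x + e * (100 * x / S)" by simp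
  also have "\<dots> = 100 * x * (S + e) / S" using assms by (simp add: field_simps)
  finally have "(x + e * y) / sqrt (S + e) ^ 3 \<le> (100 * x * (S + e) / S) / ((S + e) * sqrt (S + e))"
    unfolding cube[OF add_pos_nonneg[OF assms(1,2)]]
    by (rule divide_right_mono) (use assms in auto)
  also have "\<dots> = 100 * x / S / sqrt (S + e)" using assms by simp
  also have "\<dots> \<le> 100 * x / S / sqrt S"
    using assms by (intro divide_left_mono) auto
  also have "\<dots> = 100 * (x / sqrt S ^ 3)" using assms by (simp add: cube)
  finally show ?thesis .
qed

text \<open>With \<open>y\<close> the norm of \<open>Y\<close>, regularising by \<open>r\<close>
  costs at most \<open>r\<close> of flux: for \<open>y \<ge> r\<close> the root is at most
  \<open>y + r\<close>, and otherwise the left side is negative.\<close>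

lemma regularised_norm_bound:
  fixes y r :: real
  assumes "y \<ge> 0" "r > 0"
  shows "y - r \<le> y\<^sup>2 / sqrt (y\<^sup>2 + r\<^sup>2)"
proof -
  have pos: "sqrt (y\<^sup>2 + r\<^sup>2) > 0" using assms by (simp add: add_nonneg_pos)
  have "(y - r) * sqrt (y\<^sup>2 + r\<^sup>2) \<le> y\<^sup>2"
  proof (cases "y \<ge> r")
    case True
    have "sqrt (y\<^sup>2 + r\<^sup>2) \<le> y + r" using assms by (intro sqrt_sum_squares_le_sum) auto
    then have "(y - r) * sqrt (y\<^sup>2 + r\<^sup>2) \<le> (y - r) * (y + r)" using True by (intro mult_left_mono) auto
    also have "\<dots> \<le> y\<^sup>2" by (simp add: algebra_simps power2_eq_square)
    finally show ?thesis .
  next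
    case False
    then have "(y - r) * sqrt (y\<^sup>2 + r\<^sup>2) \<le> 0" using pos by (intro mult_nonpos_nonneg) auto
    then show ?thesis by (smt (verit) zero_le_power2)
  qed
  then show ?thesis using pos by (simp add: pos_le_divide_eq)
qed

section \<open>The subcalibration of the Clifford cone\<close>

text \<open>At exponent 0 the truncated subtraction is harmless, as the coefficient in front is
  0.\<close>

lemma monomial_deriv:
  fixes f g h :: "'a::real_normed_vector \<Rightarrow> real"
  assumes "(f has_derivative f') (at x)" "(g has_derivative g') (at x)" "(h has_derivative h') (at x)"
  shows "((\<lambda>x. f x ^ i * g x ^ j * h x ^ k) has_derivative
    (\<lambda>v. real i * (f x ^ (i - 1) * g x ^ j * h x ^ k) * f' v + real j * (f x ^ i * g x ^ (j - 1) * h x ^ k) * g' v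
      + real k * (f x ^ i * g x ^ j * h x ^ (k - 1)) * h' v)) (at x)"
  by (rule has_derivative_eq_rhs[OF has_derivative_mult[OF has_derivative_mult[OF
          has_derivative_power[OF assms(1)] has_derivative_power[OF assms(2)]] has_derivative_power[OF assms(3)]]])
    (simp add: fun_eq_iff distrib_left distrib_right mult_ac)

locale clifford_pair = clifford A I
  for A :: "nat \<Rightarrow> real ^ 'm ^ 'm" and I :: "nat set" +
  fixes J K :: "nat set" and n :: nat
  assumes subsets: "J \<subseteq> I" "K \<subseteq> I" and disjoint: "J \<inter> K = {}"
    and card_J: "card J = n" and card_K: "card K = n"
    and n_ge: "n \<ge> 4" and dim_ge: "CARD('m) \<ge> 32"
begin

lemma finite_J: "finite J" and finite_K: "finite K"
  using card_J card_K n_ge by (metis card.infinite not_numeral_le_zero)+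

abbreviation p :: "real ^ 'm \<Rightarrow> real ^ 'm" where "p \<equiv> grad J"
abbreviation q :: "real ^ 'm \<Rightarrow> real ^ 'm" where "q \<equiv> grad K"

definition D :: "real ^ 'm \<Rightarrow> real" where "D x = quartic J x - quartic K x"
definition s :: "real ^ 'm \<Rightarrow> real" where "s x = quartic J x + quartic K x"
definition t :: "real ^ 'm \<Rightarrow> real" where "t x = x \<bullet> x"

text \<open>The halves of \<open>s x + D x\<close> and \<open>s x - D x\<close> are the two
  quartics. Products of \<open>p\<close>, \<open>q\<close> and \<open>x\<close> are thus functions
  of \<open>D\<close>, \<open>s\<close>, \<open>t\<close>, so later computations stay in these three
  variables.\<close>

lemma p_p: "p x \<bullet> p x = t x * ((s x + D x) / 2)"
  and q_q: "q x \<bullet> q x = t x * ((s x - D x) / 2)"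
  and p_q: "p x \<bullet> q x = 0"
  and p_x: "p x \<bullet> x = (s x + D x) / 2"
  and q_x: "q x \<bullet> x = (s x - D x) / 2"
  using subsets disjoint finite_J finite_K
  by (auto simp: grad_inner_grad grad_inner_self s_def D_def t_def field_simps quartic_def)

lemma div_p: "divergence p x = 2 * n * t x"
  and div_q: "divergence q x = 2 * n * t x"
proof -
  \<comment> \<open>A second index is what makes the traces vanish.\<close>
  have 1: "\<exists>j\<in>I. j \<noteq> i" for i
  proof -
    have "\<not> J \<subseteq> {i}" using card_mono[of "{i}" J] card_J n_ge by auto
    then show ?thesis using subsets by auto
  qed
  show "divergence p x = 2 * n * t x" "divergence q x = 2 * n * t x"
    using divergence_grad[OF subsets(1) 1] divergence_grad[OF subsets(2) 1] card_J card_K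
    by (auto simp: t_def)
qed

lemma D_deriv: "(D has_derivative (\<lambda>v. 4 * ((p x - q x) \<bullet> v))) (at x)"
  unfolding D_def[abs_def]
  using has_derivative_diff[OF quartic_deriv[OF subsets(1)] quartic_deriv[OF subsets(2)]]
  by (simp add: algebra_simps)

lemma s_deriv: "(s has_derivative (\<lambda>v. 4 * ((p x + q x) \<bullet> v))) (at x)"
  unfolding s_def[abs_def]
  using has_derivative_add[OF quartic_deriv[OF subsets(1)] quartic_deriv[OF subsets(2)]]
  by (simp add: algebra_simps)

lemma t_deriv: "(t has_derivative (\<lambda>v. 2 * (x \<bullet> v))) (at x)"
  unfolding t_def[abs_def] by (auto intro!: derivative_eq_intros simp: inner_commute)

lemmas D_s_t_deriv = D_deriv s_deriv t_deriv

lemma D_C1: "C1_fun D" and s_C1: "C1_fun s" and t_C1: "C1_fun t"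
  unfolding D_def[abs_def] s_def[abs_def] t_def[abs_def]
  by (intro C1_fun_add C1_fun_diff C1_fun_inner C1_fun_id quartic_C1)+

lemmas D_cont = C1_fun_continuous[OF D_C1]
lemmas s_cont = C1_fun_continuous[OF s_C1]
lemmas t_cont = C1_fun_continuous[OF t_C1]

lemma abs_D_le: "\<bar>D x\<bar> \<le> s x"
  using quartic_nonneg[of J x] quartic_nonneg[of K x] by (simp add: D_def s_def)

lemma s_nonneg: "s x \<ge> 0"
  using abs_D_le[of x] by simp

lemma D_sq_le: "(D x)\<^sup>2 \<le> (s x)\<^sup>2"
  using abs_D_le[of x] s_nonneg[of x] by (simp add: abs_le_square_iff[symmetric])

lemma t_nonneg: "t x \<ge> 0"
  by (simp add: t_def)

lemma pos_of_D: "D x \<noteq> 0 \<Longrightarrow> s x > 0 \<and> t x > 0"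
proof -
  assume D: "D x \<noteq> 0"
  then have "x \<noteq> 0" by (auto simp: D_def quartic_def form_def)
  then show ?thesis using D abs_D_le[of x] by (auto simp: t_def)
qed

text \<open>
  \<open>Y\<close> is a positive multiple of the gradient of \<open>D s\<^bsup>2/3\<^esup> t\<close> wherever \<open>s > 0\<close>, since \<open>\<nabla>D = 4 (p - q)\<close>,
  \<open>\<nabla>s = 4 (p + q)\<close> and \<open>\<nabla>t = 2 x\<close>. The function \<open>G\<close> below is its cube, which is a polynomial.
\<close>

definition Y :: "real ^ 'm \<Rightarrow> real ^ 'm" where
  "Y x = (6 * s x * t x + 4 * D x * t x) *\<^sub>R p x + (4 * D x * t x - 6 * s x * t x) *\<^sub>R q x + (3 * D x * s x) *\<^sub>R x"

text \<open>The squared norm of \<open>Y\<close>, as \<open>Y_Y\<close> verifies.\<close>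

definition S :: "real ^ 'm \<Rightarrow> real" where
  "S x = 36 * (s x ^ 3 * t x ^ 3) + 64 * (t x ^ 3 * s x * (D x)\<^sup>2) + 69 * (t x * (s x)\<^sup>2 * (D x)\<^sup>2)"

lemma p_Y: "p x \<bullet> Y x = (s x + D x) / 2 * (6 * s x * (t x)\<^sup>2 + 4 * D x * (t x)\<^sup>2 + 3 * D x * s x)"
  and q_Y: "q x \<bullet> Y x = (s x - D x) / 2 * (4 * D x * (t x)\<^sup>2 - 6 * s x * (t x)\<^sup>2 + 3 * D x * s x)"
  and x_Y: "x \<bullet> Y x = 13 * (D x * s x * t x)"
proof -
  have qp: "q x \<bullet> p x = 0" using p_q[of x] by (simp add: inner_commute)
  have xx: "x \<bullet> x = t x" "x \<bullet> p x = (s x + D x) / 2" "x \<bullet> q x = (s x - D x) / 2"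
    using p_x[of x] q_x[of x] by (simp_all add: t_def inner_commute)
  show "p x \<bullet> Y x = (s x + D x) / 2 * (6 * s x * (t x)\<^sup>2 + 4 * D x * (t x)\<^sup>2 + 3 * D x * s x)"
    unfolding Y_def inner_add_right inner_scaleR_right p_p p_q p_x by (simp add: field_simps power2_eq_square)
  show "q x \<bullet> Y x = (s x - D x) / 2 * (4 * D x * (t x)\<^sup>2 - 6 * s x * (t x)\<^sup>2 + 3 * D x * s x)"
    unfolding Y_def inner_add_right inner_scaleR_right q_q qp q_x by (simp add: field_simps power2_eq_square)
  show "x \<bullet> Y x = 13 * (D x * s x * t x)"
    unfolding Y_def inner_add_right inner_scaleR_right xx by (simp add: field_simps power2_eq_square)
qed

lemma Y_Y: "Y x \<bullet> Y x = S x"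
proof -
  have "Y x \<bullet> Y x = (6 * s x * t x + 4 * D x * t x) * (p x \<bullet> Y x)
      + (4 * D x * t x - 6 * s x * t x) * (q x \<bullet> Y x) + (3 * D x * s x) * (x \<bullet> Y x)"
    by (subst (1) Y_def) (simp only: inner_add_left inner_scaleR_left)
  also have "\<dots> = S x"
    unfolding p_Y q_Y x_Y S_def by (simp add: field_simps power2_eq_square power3_eq_cube)
  finally show ?thesis .
qed

text \<open>The cofactor of \<open>D\<close> in the divergence of \<open>Y\<close>: \<open>n\<close>
  enters through the divergences of \<open>p\<close> and \<open>q\<close>, the dimension through
  that of \<open>x\<close>.\<close>

definition delta :: "real ^ 'm \<Rightarrow> real" where
  "delta x = (16 * n + 40) * (t x)\<^sup>2 + (3 * CARD('m) + 44) * s x"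

lemma Y_C1: "C1_fun Y"
  unfolding Y_def[abs_def]
  by (intro C1_fun_add C1_fun_diff C1_fun_scaleR C1_fun_mult C1_fun_const C1_fun_id grad_C1 D_C1 s_C1 t_C1)

lemma div_Y: "divergence Y x = D x * delta x"
proof -
  have 1: "((\<lambda>x. 6 * s x * t x + 4 * D x * t x) has_derivative
     (\<lambda>v. (6 * s x + 4 * D x) * (2 * (x \<bullet> v)) + 6 * t x * (4 * ((p x + q x) \<bullet> v)) + 4 * t x * (4 * ((p x - q x) \<bullet> v)))) (at x)"
    by (auto intro!: derivative_eq_intros D_s_t_deriv simp: algebra_simps)
  have 2: "((\<lambda>x. 4 * D x * t x - 6 * s x * t x) has_derivative
     (\<lambda>v. (4 * D x - 6 * s x) * (2 * (x \<bullet> v)) - 6 * t x * (4 * ((p x + q x) \<bullet> v)) + 4 * t x * (4 * ((p x - q x) \<bullet> v)))) (at x)"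
    by (auto intro!: derivative_eq_intros D_s_t_deriv simp: algebra_simps)
  have 3: "((\<lambda>x. 3 * D x * s x) has_derivative
     (\<lambda>v. 3 * s x * (4 * ((p x - q x) \<bullet> v)) + 3 * D x * (4 * ((p x + q x) \<bullet> v)))) (at x)"
    by (auto intro!: derivative_eq_intros D_s_t_deriv simp: algebra_simps)
  have c: "C1_fun (\<lambda>x. 6 * s x * t x + 4 * D x * t x)" "C1_fun (\<lambda>x. 4 * D x * t x - 6 * s x * t x)" "C1_fun (\<lambda>x. 3 * D x * s x)"
    by (intro C1_fun_add C1_fun_diff C1_fun_mult C1_fun_const D_C1 s_C1 t_C1)+
  have qp: "q x \<bullet> p x = 0" using p_q[of x] by (simp add: inner_commute)
  have xx: "x \<bullet> x = t x" "x \<bullet> p x = (s x + D x) / 2" "x \<bullet> q x = (s x - D x) / 2"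
    using p_x[of x] q_x[of x] by (simp_all add: t_def inner_commute)
  have "divergence Y x = divergence (\<lambda>x. (6 * s x * t x + 4 * D x * t x) *\<^sub>R p x) x
      + divergence (\<lambda>x. (4 * D x * t x - 6 * s x * t x) *\<^sub>R q x) x + divergence (\<lambda>x. (3 * D x * s x) *\<^sub>R x) x"
    unfolding Y_def[abs_def] using c
    by (simp add: divergence_add C1_fun_add C1_fun_scaleR grad_C1 C1_fun_id)
  also have "\<dots> = D x * delta x"
    unfolding divergence_scaleR[OF 1 grad_C1] divergence_scaleR[OF 2 grad_C1] divergence_scaleR[OF 3 C1_fun_id]
      div_p div_q divergence_id inner_add_left inner_diff_left p_p q_q p_q qp p_x q_x xx delta_def
    by (simp add: field_simps power2_eq_square)
  finally show ?thesis .
qed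

text \<open>The cofactor of \<open>D x * s x * t x\<close> in the derivative of \<open>S\<close>
  along \<open>Y\<close>.\<close>

definition Z :: "real ^ 'm \<Rightarrow> real" where
  "Z x = (108 * (s x)\<^sup>2 * (t x)\<^sup>2 + 64 * (t x)\<^sup>2 * (D x)\<^sup>2 + 138 * s x * (D x)\<^sup>2) * (40 * (t x)\<^sup>2 + 12 * s x)
      + (128 * (t x)\<^sup>2 + 138 * s x) * (24 * (t x)\<^sup>2 * (s x)\<^sup>2 + 16 * (t x)\<^sup>2 * (D x)\<^sup>2 + 12 * (D x)\<^sup>2 * s x)
      + 26 * (108 * s x ^ 3 * (t x)\<^sup>2 + 192 * (t x)\<^sup>2 * s x * (D x)\<^sup>2 + 69 * (s x)\<^sup>2 * (D x)\<^sup>2)"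

text \<open>The differential of \<open>S\<close>, grouped by the differentials of \<open>s\<close>,
  \<open>D\<close> and \<open>t\<close>.\<close>

definition S' :: "real ^ 'm \<Rightarrow> real ^ 'm \<Rightarrow> real" where
  "S' x v = (108 * ((s x)\<^sup>2 * t x ^ 3) + 64 * (t x ^ 3 * (D x)\<^sup>2) + 138 * (t x * s x * (D x)\<^sup>2)) * (4 * ((p x + q x) \<bullet> v))
    + (128 * (t x ^ 3 * s x * D x) + 138 * (t x * (s x)\<^sup>2 * D x)) * (4 * ((p x - q x) \<bullet> v))
    + (108 * (s x ^ 3 * (t x)\<^sup>2) + 192 * ((t x)\<^sup>2 * s x * (D x)\<^sup>2) + 69 * ((s x)\<^sup>2 * (D x)\<^sup>2)) * (2 * (x \<bullet> v))"

lemma S_deriv: "(S has_derivative S' x) (at x)"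
proof -
  \<comment> \<open>The exponents 0 and 1 are spelled out so that \<open>monomial_deriv\<close>
    matches every term.\<close>
  have "((\<lambda>x. 36 * (s x ^ 3 * D x ^ 0 * t x ^ 3) + 64 * (s x ^ 1 * D x ^ 2 * t x ^ 3)
      + 69 * (s x ^ 2 * D x ^ 2 * t x ^ 1)) has_derivative S' x) (at x)"
    by (rule has_derivative_eq_rhs, (rule has_derivative_add has_derivative_mult_right monomial_deriv D_s_t_deriv)+)
      (simp add: S'_def fun_eq_iff distrib_left distrib_right mult_ac)
  then show ?thesis by (simp add: S_def[abs_def] mult_ac)
qed

lemma S'_Y: "S' x (Y x) = D x * s x * t x * Z x"
  unfolding S'_def inner_add_left inner_diff_left p_Y q_Y x_Y Z_def
  by (simp add: field_simps power2_eq_square power3_eq_cube)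

lemma S_nonneg: "S x \<ge> 0"
  unfolding S_def using s_nonneg t_nonneg by (intro add_nonneg_nonneg mult_nonneg_nonneg) auto

lemma S_C1: "C1_fun S"
  unfolding S_def[abs_def] by (intro C1_fun_add C1_fun_mult C1_fun_const C1_fun_power D_C1 s_C1 t_C1)

text \<open>Where \<open>S\<close> is positive, the normalised field \<open>Y / sqrt S\<close> has
  divergence \<open>D * M / sqrt S ^ 3\<close>.\<close>

definition M :: "real ^ 'm \<Rightarrow> real" where
  "M x = delta x * S x - s x * t x * Z x / 2"

lemma delta_nonneg: "delta x \<ge> 0"
  unfolding delta_def using s_nonneg by simp

text \<open>Beyond the sign of \<open>M\<close>, this compares it with the term that regularisation
  adds to the numerator, uniformly in \<open>k\<close>. The common factor \<open>s x * t x\<close>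
  of \<open>S\<close> and of the subtracted term reduces it to the polynomial inequality.\<close>

lemma M_bound: "delta x * S x \<le> 100 * M x"
proof -
  define P where "P = 36 * (t x)\<^sup>2 * (s x)\<^sup>2 + 64 * (t x)\<^sup>2 * (D x)\<^sup>2 + 69 * (D x)\<^sup>2 * s x"
  have 1: "S x = s x * t x * P" unfolding S_def P_def by (simp add: field_simps power2_eq_square power3_eq_cube)
  \<comment> \<open>The bounds on \<open>n\<close> and on the dimension enter here.\<close>
  have "104 * (t x)\<^sup>2 + 140 * s x \<le> delta x"
    unfolding delta_def using s_nonneg[of x] n_ge dim_ge by (intro add_mono mult_right_mono) auto
  then have "Z x / 2 \<le> (99 / 100) * (delta x * P)"
    unfolding P_def Z_def by (intro subcalibration_inequality s_nonneg D_sq_le) auto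
  then have "(s x * t x) * (Z x / 2) \<le> (s x * t x) * ((99 / 100) * (delta x * P))"
    using s_nonneg t_nonneg by (intro mult_left_mono) auto
  then show ?thesis unfolding M_def 1 by (simp add: algebra_simps)
qed

lemma M_nonneg: "M x \<ge> 0"
  using M_bound[of x] delta_nonneg[of x] S_nonneg[of x] by (smt (verit) mult_nonneg_nonneg)

section \<open>Regularised unit normals and their divergence\<close>

definition \<xi> :: "nat \<Rightarrow> real ^ 'm \<Rightarrow> real ^ 'm" where
  "\<xi> k x = (1 / sqrt (S x + (1 / Suc k)\<^sup>2)) *\<^sub>R Y x"

lemma S_reg_pos: "S x + (1 / real (Suc k))\<^sup>2 > 0"
  using S_nonneg[of x] by (intro add_nonneg_pos) auto

lemma xi_C1: "C1_fun (\<xi> k)"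
proof -
  have "((\<lambda>u. 1 / sqrt (u + (1 / real (Suc k))\<^sup>2)) has_real_derivative
      - (1 / (2 * sqrt (S x + (1 / real (Suc k))\<^sup>2) * (S x + (1 / real (Suc k))\<^sup>2)))) (at (S x))" for x
    using S_reg_pos[of x k] by (auto intro!: derivative_eq_intros simp: field_simps)
  then have "C1_fun (\<lambda>x. 1 / sqrt (S x + (1 / real (Suc k))\<^sup>2))"
    using S_reg_pos[of _ k]
    by (intro C1_fun_compose_real[OF S_C1, where h="\<lambda>u. 1 / sqrt (u + (1 / real (Suc k))\<^sup>2)"
        and h'="\<lambda>u. - (1 / (2 * sqrt (u + (1 / real (Suc k))\<^sup>2) * (u + (1 / real (Suc k))\<^sup>2)))"])
      (auto intro!: continuous_intros simp: less_le)
  then show ?thesis unfolding \<xi>_def[abs_def] by (intro C1_fun_scaleR Y_C1)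
qed

text \<open>Regularisation adds a nonnegative multiple of \<open>delta\<close> to the numerator, so
  the sign is still that of \<open>D\<close>.\<close>

lemma div_xi: "divergence (\<xi> k) x = D x * (M x + (1 / Suc k)\<^sup>2 * delta x) / sqrt (S x + (1 / Suc k)\<^sup>2) ^ 3"
proof -
  define R where "R = sqrt (S x + (1 / real (Suc k))\<^sup>2)"
  have R: "R > 0" "R * R = S x + (1 / real (Suc k))\<^sup>2" using S_reg_pos[of x k] unfolding R_def by auto
  have "((\<lambda>x. 1 / sqrt (S x + (1 / real (Suc k))\<^sup>2)) has_derivative (\<lambda>v. - (S' x v) / (2 * R ^ 3))) (at x)"
    using S_reg_pos[of x k] unfolding R_def
    by (auto intro!: derivative_eq_intros S_deriv simp: field_simps power3_eq_cube)
  then have "divergence (\<xi> k) x = (1 / R) * (D x * delta x) - D x * s x * t x * Z x / (2 * R ^ 3)"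
    unfolding \<xi>_def[abs_def] by (simp add: divergence_scaleR Y_C1 div_Y S'_Y R_def)
  also have "\<dots> = D x * (delta x * (R * R) - s x * t x * Z x / 2) / R ^ 3"
    using R(1) by (simp add: field_simps power3_eq_cube)
  also have "\<dots> = D x * (M x + (1 / Suc k)\<^sup>2 * delta x) / R ^ 3"
    unfolding R(2) M_def by (simp add: algebra_simps)
  finally show ?thesis unfolding R_def .
qed

definition G :: "real ^ 'm \<Rightarrow> real" where "G x = D x ^ 3 * ((s x)\<^sup>2 * t x ^ 3)"

text \<open>The nonnegative factor by which the gradient of \<open>G\<close> differs from
  \<open>Y\<close>.\<close>

definition lambda :: "real ^ 'm \<Rightarrow> real" where "lambda x = 2 * ((D x)\<^sup>2 * s x * (t x)\<^sup>2)"

lemma G_deriv: "(G has_derivative (\<lambda>v. (lambda x *\<^sub>R Y x) \<bullet> v)) (at x)"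
proof -
  have "(G has_derivative (\<lambda>v. 3 * ((D x)\<^sup>2 * ((s x)\<^sup>2 * t x ^ 3)) * (4 * ((p x - q x) \<bullet> v))
     + 2 * (D x ^ 3 * s x * t x ^ 3) * (4 * ((p x + q x) \<bullet> v)) + 3 * (D x ^ 3 * (s x)\<^sup>2 * (t x)\<^sup>2) * (2 * (x \<bullet> v)))) (at x)"
    using monomial_deriv[OF D_deriv s_deriv t_deriv, of 3 2 3]
    by (simp add: G_def[abs_def] mult_ac)
  moreover have "3 * ((D x)\<^sup>2 * ((s x)\<^sup>2 * t x ^ 3)) * (4 * ((p x - q x) \<bullet> v))
     + 2 * (D x ^ 3 * s x * t x ^ 3) * (4 * ((p x + q x) \<bullet> v)) + 3 * (D x ^ 3 * (s x)\<^sup>2 * (t x)\<^sup>2) * (2 * (x \<bullet> v))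
     = (lambda x *\<^sub>R Y x) \<bullet> v" for v
    unfolding lambda_def Y_def inner_scaleR_left inner_add_left inner_diff_left
    by (simp add: algebra_simps power2_eq_square power3_eq_cube)
  ultimately show ?thesis by simp
qed

lemma G_neg_iff: "G x < 0 \<longleftrightarrow> D x < 0"
proof (cases "D x = 0")
  case True
  then show ?thesis by (simp add: G_def)
next
  case False
  define c where "c = (s x)\<^sup>2 * t x ^ 3"
  have "c > 0" using pos_of_D[OF False] unfolding c_def by simp
  then show ?thesis
    unfolding G_def c_def[symmetric] by (auto simp: mult_less_0_iff power_less_zero_eq)
qed

lemma lambda_nonneg: "lambda x \<ge> 0"
  unfolding lambda_def using s_nonneg by simp

definition d :: "real ^ 'm \<Rightarrow> real" where "d x = D x * M x / sqrt (S x) ^ 3"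

lemma S_pos: "D x \<noteq> 0 \<Longrightarrow> S x > 0"
proof -
  assume "D x \<noteq> 0"
  then have "s x ^ 3 * t x ^ 3 > 0" using pos_of_D by simp
  moreover have "64 * (t x ^ 3 * s x * (D x)\<^sup>2) + 69 * (t x * (s x)\<^sup>2 * (D x)\<^sup>2) \<ge> 0"
    using s_nonneg t_nonneg by simp
  ultimately show ?thesis unfolding S_def by linarith
qed

text \<open>\<open>lambda\<close> also serves as the weight of the flux error:
  \<open>Y x \<bullet> \<xi> k x\<close> falls short of the norm of \<open>Y x\<close> by at most
  \<open>1 / Suc k\<close>. The constant 100 is that of \<open>M_bound\<close>.\<close>

lemma subcalibration_xi: "subcalibration G (\<lambda>x. lambda x *\<^sub>R Y x) \<xi> lambda d (\<lambda>k. 1 / Suc k) 100"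
proof
  show "(G has_derivative (\<lambda>v. (lambda x *\<^sub>R Y x) \<bullet> v)) (at x)" for x by (rule G_deriv)
  show lambda: "continuous_on UNIV lambda"
    unfolding lambda_def by (intro continuous_intros D_cont s_cont t_cont)
  show "continuous_on UNIV (\<lambda>x. lambda x *\<^sub>R Y x)"
    by (intro continuous_intros lambda C1_fun_continuous[OF Y_C1])
  show "C1_fun (\<xi> k)" for k by (rule xi_C1)
  have nY: "norm (Y x) = sqrt (S x)" for x by (simp add: norm_eq_sqrt_inner Y_Y)
  show "norm (\<xi> k x) \<le> 1" for k x
    using S_reg_pos[of x k] S_nonneg[of x] unfolding \<xi>_def by (simp add: nY divide_le_eq_1)
  have Nxi: "(lambda x *\<^sub>R Y x) \<bullet> \<xi> k x = lambda x * (S x / sqrt (S x + (1 / Suc k)\<^sup>2))" for k x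
    unfolding \<xi>_def by (simp add: Y_Y)
  show "0 \<le> (lambda x *\<^sub>R Y x) \<bullet> \<xi> k x" for k x
    unfolding Nxi using lambda_nonneg S_nonneg S_reg_pos[of x k] by (intro mult_nonneg_nonneg divide_nonneg_nonneg) auto
  show "norm (lambda x *\<^sub>R Y x) - lambda x * (1 / Suc k) \<le> (lambda x *\<^sub>R Y x) \<bullet> \<xi> k x" for k x
  proof -
    have "sqrt (S x) - 1 / Suc k \<le> S x / sqrt (S x + (1 / Suc k)\<^sup>2)"
      using regularised_norm_bound[of "sqrt (S x)" "1 / Suc k"] S_nonneg[of x] by simp
    then have "lambda x * (sqrt (S x) - 1 / Suc k) \<le> lambda x * (S x / sqrt (S x + (1 / Suc k)\<^sup>2))"
      by (rule mult_left_mono[OF _ lambda_nonneg])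
    then show ?thesis unfolding Nxi using lambda_nonneg[of x] by (simp add: nY algebra_simps)
  qed
  show lim0: "(\<lambda>k. 1 / real (Suc k)) \<longlonglongrightarrow> 0"
    using LIMSEQ_inverse_real_of_nat by (simp add: inverse_eq_divide)
  have nonneg: "(M x + (1 / Suc k)\<^sup>2 * delta x) / sqrt (S x + (1 / Suc k)\<^sup>2) ^ 3 \<ge> 0" for x k
    using M_nonneg delta_nonneg S_reg_pos[of x k] by (intro divide_nonneg_nonneg add_nonneg_nonneg) auto
  show "divergence (\<xi> k) x \<le> 0" if "G x < 0" for k x
    using that nonneg[of x k] unfolding G_neg_iff div_xi
    by (simp only: times_divide_eq_right[symmetric]) (rule mult_nonpos_nonneg, auto)
  show "divergence (\<xi> k) x \<ge> 0" if "G x \<ge> 0" for k x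
    using that nonneg[of x k] G_neg_iff[of x] unfolding div_xi
    by (simp only: times_divide_eq_right[symmetric]) (rule mult_nonneg_nonneg, auto)
  show "(\<lambda>k. divergence (\<xi> k) x) \<longlonglongrightarrow> d x" if "G x < 0" for x
  proof -
    have "S x > 0" using that S_pos G_neg_iff by force
    then have "(\<lambda>k. D x * (M x + (1 / real (Suc k))\<^sup>2 * delta x) / sqrt (S x + (1 / real (Suc k))\<^sup>2) ^ 3)
        \<longlonglongrightarrow> D x * (M x + 0\<^sup>2 * delta x) / sqrt (S x + 0\<^sup>2) ^ 3"
      by (intro tendsto_intros lim0) auto
    then show ?thesis unfolding div_xi d_def by simp
  qed
  show "\<bar>divergence (\<xi> k) x\<bar> \<le> 100 * \<bar>d x\<bar>" if "G x < 0" for k x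
  proof -
    have "S x > 0" using that S_pos G_neg_iff by force
    then have "(M x + (1 / Suc k)\<^sup>2 * delta x) / sqrt (S x + (1 / Suc k)\<^sup>2) ^ 3 \<le> 100 * (M x / sqrt (S x) ^ 3)"
      by (intro regularisation_bound M_nonneg M_bound) auto
    then have "\<bar>D x\<bar> * ((M x + (1 / Suc k)\<^sup>2 * delta x) / sqrt (S x + (1 / Suc k)\<^sup>2) ^ 3) \<le> \<bar>D x\<bar> * (100 * (M x / sqrt (S x) ^ 3))"
      by (rule mult_left_mono) simp
    moreover have "\<bar>divergence (\<xi> k) x\<bar> = \<bar>D x\<bar> * ((M x + (1 / Suc k)\<^sup>2 * delta x) / sqrt (S x + (1 / Suc k)\<^sup>2) ^ 3)"
      unfolding div_xi times_divide_eq_right[symmetric] abs_mult abs_of_nonneg[OF nonneg] ..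
    moreover have "\<bar>d x\<bar> = \<bar>D x\<bar> * (M x / sqrt (S x) ^ 3)"
      unfolding d_def times_divide_eq_right[symmetric] abs_mult using M_nonneg[of x] S_nonneg[of x] by simp
    ultimately show ?thesis by (simp only: mult.left_commute)
  qed
qed

lemma minimal_domain: "minimal_in {x. D x < 0} UNIV"
proof -
  interpret subcalibration G "\<lambda>x. lambda x *\<^sub>R Y x" \<xi> lambda d "\<lambda>k. 1 / Suc k" 100
    by (rule subcalibration_xi)
  show ?thesis using minimal unfolding E_def G_neg_iff .
qed

text \<open>
  Every zero of \<open>D\<close> starts a segment on which \<open>D\<close> is negative: along \<open>- \<nabla>D\<close> if \<open>s \<noteq> 0\<close>, along
  \<open>A\<^sub>j x\<close> if \<open>s = 0\<close> and \<open>x \<noteq> 0\<close>, and along an eigenvector of \<open>A\<^sub>j\<close> if \<open>x = 0\<close>, with \<open>j \<in> K\<close>.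
\<close>

lemma D_along_derivative:
  assumes "D x = 0" "s x \<noteq> 0"
  shows "\<exists>v. \<exists>\<epsilon>>0. \<forall>h>0. h < \<epsilon> \<longrightarrow> D (x + h *\<^sub>R v) < 0"
proof -
  define v where "v = q x - p x"
  have "x \<noteq> 0" using assms(2) by (auto simp: s_def quartic_def form_def)
  then have pos: "t x * s x > 0" using assms(2) s_nonneg[of x] by (simp add: t_def)
  have 1: "((\<lambda>h. x + h *\<^sub>R v) has_derivative (\<lambda>h. h *\<^sub>R v)) (at 0)"
    by (auto intro!: derivative_eq_intros)
  have "((\<lambda>h. D (x + h *\<^sub>R v)) has_derivative (\<lambda>h. 4 * ((p (x + 0 *\<^sub>R v) - q (x + 0 *\<^sub>R v)) \<bullet> (h *\<^sub>R v)))) (at 0)"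
    by (rule has_derivative_compose[OF 1 D_deriv])
  moreover have "(\<lambda>h. 4 * ((p (x + 0 *\<^sub>R v) - q (x + 0 *\<^sub>R v)) \<bullet> (h *\<^sub>R v))) = (*) (4 * ((p x - q x) \<bullet> v))"
    by (simp add: fun_eq_iff)
  ultimately have "((\<lambda>h. D (x + h *\<^sub>R v)) has_real_derivative 4 * ((p x - q x) \<bullet> v)) (at 0)"
    unfolding has_field_derivative_def by simp
  moreover have "(p x - q x) \<bullet> v = - (t x * s x)"
    unfolding v_def by (simp add: inner_diff_left inner_diff_right p_p q_q p_q inner_commute[of "q x" "p x"] field_simps)
  ultimately obtain \<epsilon> where "\<epsilon> > 0" "\<forall>h>0. h < \<epsilon> \<longrightarrow> D (x + 0 *\<^sub>R v) > D (x + (0 + h) *\<^sub>R v)"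
    using DERIV_neg_dec_right[of "\<lambda>h. D (x + h *\<^sub>R v)" _ 0] pos by fastforce
  then show ?thesis using assms(1) by auto
qed

lemma form_along:
  assumes "i \<in> I"
  shows "form i (x + h *\<^sub>R v) = form i x + 2 * h * ((A i *v x) \<bullet> v) + h\<^sup>2 * form i v"
proof -
  have "v \<bullet> (A i *v x) = (A i *v x) \<bullet> v" "x \<bullet> (A i *v v) = (A i *v x) \<bullet> v"
    using adjoint[OF assms, of x v] by (simp_all add: inner_commute)
  then show ?thesis
    unfolding form_def
    by (simp add: matrix_vector_right_distrib matrix_vector_mult_scaleR inner_add_left inner_add_right power2_eq_square algebra_simps)
qed

lemma K_nonempty: "\<exists>j. j \<in> K"
  using card_K n_ge by (metis card.empty ex_in_conv not_numeral_le_zero)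

text \<open>All forms indexed by \<open>J \<union> K\<close> vanish at both \<open>x\<close> and
  \<open>A j *v x\<close>, so along the line only the mixed term survives, and orthogonality
  confines it to \<open>i = j\<close>.\<close>

lemma D_along_involution:
  assumes "s x = 0" "x \<noteq> 0"
  shows "\<exists>v. \<forall>h>0. D (x + h *\<^sub>R v) < 0"
proof -
  obtain j where j: "j \<in> K" using K_nonempty by blast
  then have jI: "j \<in> I" "j \<notin> J" using subsets disjoint by auto
  define v where "v = A j *v x"
  have q0: "quartic J x = 0" "quartic K x = 0"
    using assms(1) quartic_nonneg[of J x] quartic_nonneg[of K x] by (auto simp: s_def)
  have f0: "form i x = 0" if "i \<in> J \<union> K" for i
    using that q0 finite_J finite_K unfolding quartic_def by (auto simp: sum_nonneg_eq_0_iff)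
  have fv: "form i v = 0" if i: "i \<in> J \<union> K" for i
  proof (cases "i = j")
    case True
    have "form j v = (A j *v v) \<bullet> v" by (simp add: form_def inner_commute)
    also have "\<dots> = x \<bullet> (A j *v x)" unfolding v_def involution[OF jI(1)] ..
    finally show ?thesis using f0[OF i] True by (simp add: form_def)
  next
    case False
    have iI: "i \<in> I" using i subsets by auto
    have "form i v = v \<bullet> (A i *v (A j *v x))" by (simp add: form_def v_def)
    also have "\<dots> = - ((A j *v x) \<bullet> (A j *v (A i *v x)))"
      using anticommute_vec[OF iI jI(1) False] by (simp add: v_def)
    also have "\<dots> = - (x \<bullet> (A i *v x))"
      using adjoint[OF jI(1)] involution[OF jI(1)] by simp
    finally show ?thesis using f0[OF i] by (simp add: form_def)
  qed
  have along: "form i (x + h *\<^sub>R v) = (if i = j then 2 * h * t x else 0)" if i: "i \<in> J \<union> K" for i h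
  proof -
    have iI: "i \<in> I" using i subsets by auto
    show ?thesis
      using form_along[OF iI, of x h v] f0[OF i] fv[OF i] orthogonal[OF iI jI(1), of x]
      by (simp add: v_def t_def)
  qed
  have "D (x + h *\<^sub>R v) < 0" if "h > 0" for h
  proof -
    have "quartic J (x + h *\<^sub>R v) = 0"
      unfolding quartic_def using along jI(2) by (intro sum.neutral) auto
    moreover have "quartic K (x + h *\<^sub>R v) \<ge> (form j (x + h *\<^sub>R v))\<^sup>2"
      unfolding quartic_def using j finite_K by (intro member_le_sum) auto
    moreover have "(form j (x + h *\<^sub>R v))\<^sup>2 > 0"
      using along[of j h] j that assms(2) by (simp add: t_def)
    ultimately show ?thesis unfolding D_def by linarith
  qed
  then show ?thesis by blast
qed

lemma D_along_ray: "\<exists>v. \<forall>h>0. D (0 + h *\<^sub>R v) < 0"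
proof -
  obtain j where j: "j \<in> K" using K_nonempty by blast
  then have jI: "j \<in> I" "j \<notin> J" using subsets disjoint by auto
  obtain y :: "real ^ 'm" where y: "y \<noteq> 0" using nonzero_Basis nonempty_Basis by blast
  \<comment> \<open>As \<open>A j\<close> is an involution, \<open>y + A j *v y\<close> is fixed by
    it; if this vector is 0, then \<open>y\<close> has eigenvalue -1.\<close>
  have "\<exists>z c. z \<noteq> 0 \<and> c \<noteq> 0 \<and> A j *v z = c *\<^sub>R z"
  proof (cases "y + A j *v y = 0")
    case True
    then have "A j *v y = (-1) *\<^sub>R y" by (simp add: eq_neg_iff_add_eq_0 add.commute)
    then show ?thesis using y by (intro exI[of _ y] exI[of _ "-1"]) auto
  next
    case False
    then show ?thesis
      using involution[OF jI(1), of y]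
      by (intro exI[of _ "y + A j *v y"] exI[of _ 1]) (auto simp: matrix_vector_right_distrib add.commute)
  qed
  then obtain z c where z: "z \<noteq> 0" "c \<noteq> 0" "A j *v z = c *\<^sub>R z" by blast
  \<comment> \<open>On an eigenvector of \<open>A j\<close> the form of \<open>A i\<close> is a
    multiple of an inner product that vanishes by orthogonality.\<close>
  have "form i z = 0" if "i \<in> J" for i
  proof -
    have iI: "i \<in> I" "i \<noteq> j" using that subsets jI by auto
    have "c * form i z = (A j *v z) \<bullet> (A i *v z)" unfolding z(3) by (simp add: form_def)
    then show ?thesis using orthogonal[OF jI(1) iI(1), of z] iI(2) z(2) by auto
  qed
  then have "quartic J z = 0" unfolding quartic_def by simp
  moreover have "quartic K z \<ge> (form j z)\<^sup>2"
    unfolding quartic_def using j finite_K by (intro member_le_sum) auto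
  moreover have "(form j z)\<^sup>2 > 0" using z by (simp add: form_def)
  ultimately have "D z < 0" unfolding D_def by linarith
  then have "D (0 + h *\<^sub>R z) < 0" if "h > 0" for h
    using that by (simp add: D_def quartic_scaleR)
  then show ?thesis by blast
qed

lemma zero_in_closure:
  assumes "D x = 0"
  shows "x \<in> closure {x. D x < 0}"
proof -
  have "\<exists>v. \<exists>\<epsilon>>0. \<forall>h>0. h < \<epsilon> \<longrightarrow> D (x + h *\<^sub>R v) < 0"
  proof (cases "x = 0")
    case True
    then show ?thesis using D_along_ray zero_less_one by blast
  next
    case False
    then show ?thesis
      using D_along_derivative[OF assms] D_along_involution[OF _ False] zero_less_one by blast
  qed
  then obtain v \<epsilon> where v: "\<epsilon> > 0" "\<And>h. h > 0 \<Longrightarrow> h < \<epsilon> \<Longrightarrow> D (x + h *\<^sub>R v) < 0" by blast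
  have "((\<lambda>h. x + h *\<^sub>R v) \<longlongrightarrow> x + 0 *\<^sub>R v) (at_right 0)" by (intro tendsto_intros)
  moreover have "\<forall>\<^sub>F h in at_right 0. x + h *\<^sub>R v \<in> closure {x. D x < 0}"
    unfolding eventually_at_right_field
    by (intro exI[of _ \<epsilon>]) (auto intro!: subsetD[OF closure_subset] v)
  ultimately show ?thesis
    using Lim_in_closed_set[of "closure {x. D x < 0}" "\<lambda>h. x + h *\<^sub>R v" "at_right (0::real)"] by simp
qed

lemma frontier_domain: "frontier {x. D x < 0} = {x. D x = 0}"
proof
  have op: "open {x. D x < 0}" by (intro open_Collect_less D_cont continuous_intros)
  have "closure {x. D x < 0} \<subseteq> {x. D x \<le> 0}"
    by (rule closure_minimal) (auto intro: closed_Collect_le D_cont continuous_intros)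
  then show "frontier {x. D x < 0} \<subseteq> {x. D x = 0}"
    unfolding frontier_def interior_open[OF op] by auto
  show "{x. D x = 0} \<subseteq> frontier {x. D x < 0}"
    unfolding frontier_def interior_open[OF op] using zero_in_closure by auto
qed

end

theorem theorem1p5:
  fixes A :: "nat \<Rightarrow> real ^ 'm ^ 'm" and n :: nat
  assumes "CARD('m) \<ge> 32" and "n \<ge> 4"
    and "clifford_system (2 * n) A"
  shows "clifford_cone n A = frontier (clifford_domain n A) \<and>
         minimal_in (clifford_domain n A) UNIV"
proof -
  \<comment> \<open>The second index set is written \<open>{1 + n..n + n}\<close> to match the shift
    rule for sums used next.\<close>
  interpret clifford_pair A "{1..2 * n}" "{1..n}" "{1 + n..n + n}" n
    using assms unfolding clifford_system_def by unfold_locales auto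
  have qK: "(\<Sum>i=1..n. (x \<bullet> (A (n + i) *v x))\<^sup>2) = quartic {1 + n..n + n} x" for x
    unfolding quartic_def sum.shift_bounds_cl_nat_ivl by (simp add: form_def add.commute)
  have qJ: "(\<Sum>i=1..n. (x \<bullet> (A i *v x))\<^sup>2) = quartic {1..n} x" for x
    by (simp add: quartic_def form_def)
  have "clifford_cone n A = {x. D x = 0}" "clifford_domain n A = {x. D x < 0}"
    unfolding clifford_cone_def clifford_domain_def D_def qJ qK by auto
  then show ?thesis using frontier_domain minimal_domain by simp
qed

end
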